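(* For all integers $\ell \geq 1$ there exists an integer $k$ such that every $2$-connected graph $G$ with a $\Gamma_k$ minor contains $\Gamma_{\ell}^{+}$ or $\nabla_\ell$ as a minor.
   Context: All graphs are finite and simple. For $\ell\ge 0$, $\Gamma_\ell$ denotes the complete binary tree of height $\ell$: the rooted tree in which every non-leaf vertex has exactly two children, with $2^\ell$ leaves and every root-to-leaf path having exactly $\ell$ edges. $\Gamma_\ell^+$ is obtained from $\Gamma_\ell$ by adding one new vertex adjacent to all leaves of $\Gamma_\ell$. The graphs $\nabla_\ell$ ($\ell\ge1$), each with a designated root edge, are defined recursively: $\nabla_1$ is a triangle with one edge designated as root edge; $\nabla_{\ell+1}$ is obtained by taking two disjoint copies of $\nabla_\ell$ with root edges $e_1,e_2$ and a triangle with edges $e_1',e_2',e_3$, identifying $e_i$ with $e_i'$ for $i=1,2$, and declaring $e_3$ the root edge. *)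

theory Defs
  imports "Graph_Theory.Digraph_Component" "Graph_Theory.Pair_Digraph"
begin

text \<open>
  Finite simple graphs are rendered by the locale \<^locale>\<open>pair_graph\<close>: a finite vertex set together
  with a finite, symmetric, irreflexive set of arcs between vertices. An undirected edge \<open>uv\<close> is
  the pair of arcs \<open>(u, v)\<close>, \<open>(v, u)\<close>. Connected graphs are nonempty by definition.
\<close>

definition k_connected :: "nat \<Rightarrow> 'a pair_pre_digraph \<Rightarrow> bool" where
  "k_connected k G \<longleftrightarrow>
     k < card (pverts G) \<and>
     (\<forall>X \<subseteq> pverts G. card X < k \<longrightarrow> connected (with_proj G \<restriction> (pverts G - X)))"

text \<open>\<open>B v\<close> is the branch set of \<open>v\<close>, i.e. the set of vertices of \<open>G\<close> contracted to \<open>v\<close>.\<close>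

definition minor_model ::
    "'b pair_pre_digraph \<Rightarrow> 'a pair_pre_digraph \<Rightarrow> ('b \<Rightarrow> 'a set) \<Rightarrow> bool" where
  "minor_model H G B \<longleftrightarrow>
     (\<forall>v \<in> pverts H. B v \<subseteq> pverts G \<and> connected (with_proj G \<restriction> B v)) \<and>
     (\<forall>u \<in> pverts H. \<forall>v \<in> pverts H. u \<noteq> v \<longrightarrow> B u \<inter> B v = {}) \<and>
     (\<forall>(u, v) \<in> parcs H. \<exists>x \<in> B u. \<exists>y \<in> B v. (x, y) \<in> parcs G)"

definition is_minor :: "'b pair_pre_digraph \<Rightarrow> 'a pair_pre_digraph \<Rightarrow> bool" where
  "is_minor H G \<longleftrightarrow> (\<exists>B. minor_model H G B)"

text \<open>
  A vertex of the complete binary tree is the list of left/right choices leading to it, most recent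
  choice first: the root is \<open>[]\<close>, the children of \<open>xs\<close> are \<open>True # xs\<close> and \<open>False # xs\<close>, and the
  leaves are the lists of length \<open>l\<close>.
\<close>

definition bin_tree :: "nat \<Rightarrow> bool list pair_pre_digraph" where
  "bin_tree l = \<lparr> pverts = {xs. length xs \<le> l},
     parcs = {(xs, b # xs) | xs b. length xs < l} \<union> {(b # xs, xs) | xs b. length xs < l} \<rparr>"

text \<open>\<open>None\<close> is the additional vertex.\<close>

definition bin_tree_plus :: "nat \<Rightarrow> bool list option pair_pre_digraph" where
  "bin_tree_plus l = \<lparr> pverts = insert None (Some ` pverts (bin_tree l)),
     parcs = map_prod Some Some ` parcs (bin_tree l)
       \<union> {(None, Some xs) | xs. length xs = l} \<union> {(Some xs, None) | xs. length xs = l} \<rparr>"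

text \<open>
  \<open>nabla l\<close> has vertex set \<open>{0..2 ^ l}\<close> and root edge joining \<open>0\<close> and \<open>2 ^ l\<close>. In the step, the
  triangle has the vertices \<open>0\<close>, \<open>2 ^ l\<close>, \<open>2 ^ Suc l\<close>; the first copy of \<open>nabla l\<close> has root edge
  from \<open>0\<close> to \<open>2 ^ l\<close>, the second one, translated by \<open>2 ^ l\<close>, has root edge from \<open>2 ^ l\<close> to
  \<open>2 ^ Suc l\<close>, and the two share only the vertex \<open>2 ^ l\<close>; the third edge of the triangle is new.
  The recursion is started one step early, from a single edge, so that \<open>nabla 1\<close> is the triangle.
\<close>

primrec nabla :: "nat \<Rightarrow> nat pair_pre_digraph" where
  "nabla 0 = \<lparr> pverts = {0, 1}, parcs = {(0, 1), (1, 0)} \<rparr>"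
| "nabla (Suc l) = \<lparr> pverts = pverts (nabla l) \<union> (\<lambda>i. i + 2 ^ l) ` pverts (nabla l),
     parcs = parcs (nabla l) \<union> map_prod (\<lambda>i. i + 2 ^ l) (\<lambda>i. i + 2 ^ l) ` parcs (nabla l)
       \<union> {(0, 2 ^ Suc l), (2 ^ Suc l, 0)} \<rparr>"

lemma nabla_1:
  "nabla 1 = \<lparr> pverts = {0, 1, 2}, parcs = {(0, 1), (1, 0), (1, 2), (2, 1), (0, 2), (2, 0)} \<rparr>"
  by (auto simp: numeral_2_eq_2)

lemma pverts_nabla: "pverts (nabla l) = {0..2 ^ l}"
proof (induction l)
  case (Suc l)
  have "{0..2 ^ l} \<union> (\<lambda>i. i + 2 ^ l) ` {0..2 ^ l} = {0..(2::nat) ^ Suc l}"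
    by (simp add: image_add_atLeastAtMost' ivl_disj_un_two_touch mult_2)
  then show ?case by (simp add: Suc)
qed auto

lemma root_nabla: "(0, 2 ^ l) \<in> parcs (nabla l)"
  by (cases l) auto

lemma leaves_bin_tree: "card {xs \<in> pverts (bin_tree l). length xs = l} = 2 ^ l"
proof -
  have "{xs \<in> pverts (bin_tree l). length xs = l} = {xs. set xs \<subseteq> UNIV \<and> length xs = l}"
    by (auto simp: bin_tree_def)
  then show ?thesis
    using card_lists_length_eq[of "UNIV :: bool set" l] by simp
qed

lemma pair_graphI:
  assumes "finite (pverts G)" "parcs G \<subseteq> pverts G \<times> pverts G" "sym (parcs G)" "irrefl (parcs G)"
  shows "pair_graph G"
proof -
  have "finite (parcs G)"
    using assms(1,2) finite_subset by blast
  then show ?thesis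
    using assms by unfold_locales (auto simp: symmetric_def irrefl_def)
qed

lemma pair_graph_bin_tree: "pair_graph (bin_tree l)"
proof (rule pair_graphI)
  show "finite (pverts (bin_tree l))"
    using finite_lists_length_le[of "UNIV :: bool set" l] by (simp add: bin_tree_def)
qed (auto simp: bin_tree_def sym_def irrefl_def)

lemma pair_graph_bin_tree_plus: "pair_graph (bin_tree_plus l)"
proof -
  interpret pair_graph "bin_tree l" by (rule pair_graph_bin_tree)
  show ?thesis
  proof (rule pair_graphI)
    show "finite (pverts (bin_tree_plus l))"
      using pair_finite_verts by (simp add: bin_tree_plus_def)
  qed (auto simp: bin_tree_plus_def bin_tree_def sym_def irrefl_def)
qed

lemma pair_graph_nabla: "pair_graph (nabla l)"
proof (rule pair_graphI)
  show "finite (pverts (nabla l))"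
    by (simp add: pverts_nabla)
  show "parcs (nabla l) \<subseteq> pverts (nabla l) \<times> pverts (nabla l)"
  proof (induction l)
    case (Suc l)
    have "{0, 2 ^ Suc l} \<subseteq> pverts (nabla (Suc l))"
      by (simp add: pverts_nabla del: nabla.simps)
    with Suc show ?case by auto
  qed auto
  show "sym (parcs (nabla l))"
    by (induction l) (auto simp: sym_def)
  show "irrefl (parcs (nabla l))"
    by (induction l) (auto simp: irrefl_def)
qed

end

theory Submission
  imports Defs
begin

text \<open>
  Cover \<open>G\<close> by the branch sets of a large binary tree. Let \<open>A\<close> be the union of the branch sets below
  some tree vertex. If every subtree \<open>l\<close> levels further down has an edge leaving \<open>A\<close>, contracting the
  complement of \<open>A\<close> gives \<open>bin_tree_plus l\<close>. Otherwise some such subtree \<open>D\<close> has no edge leaving \<open>A\<close>;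
  as \<open>G\<close> is 2-connected, \<open>D\<close> then contains no cut vertex of \<open>A\<close>, so it lies in a block of \<open>A\<close>. Thus \<open>G\<close>
  contains disjoint 2-connected subgraphs \<open>W1\<close>, \<open>W2\<close> with connected complements that again have large
  binary tree minors.

  For distinct vertices \<open>a\<close>, \<open>b\<close> outside \<open>W1\<close>, \<open>W2\<close>, either disjoint connected sets containing \<open>a\<close> and \<open>b\<close>
  each meet both \<open>W1\<close> and \<open>W2\<close> (theta), or an \<open>a\<close>-\<open>b\<close> path runs through \<open>W1\<close> and then \<open>W2\<close>, with a chord
  between its first and its last piece (cycle). Apply induction inside \<open>W1\<close> and \<open>W2\<close>: a theta makes a model
  of \<open>bin_tree_plus j\<close> whose root branch set contains \<open>a\<close> and whose apex contains \<open>b\<close> grow by one level, a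
  cycle does the same for a model of \<open>nabla i\<close> with root edge \<open>ab\<close>, and the model that does not grow
  survives.
\<close>

section \<open>Connected vertex sets\<close>

text \<open>Minors found separately in \<open>W1\<close> and \<open>W2\<close> can be glued only if
  their contacts with the rest are under control, so the induction on \<open>i + j\<close> is stated
  for arbitrary prescribed \<open>a\<close> and \<open>b\<close>; inside \<open>W1\<close> and
  \<open>W2\<close> their role passes to the contact vertices of the theta or cycle. A theta alone
  would merely identify the roots of two models of \<open>bin_tree_plus\<close>, instead of making
  them children of a new root. Hence in the theta case each of \<open>W1\<close>, \<open>W2\<close>
  is entered once more: a smaller 2-connected set that avoids the contact vertices is linked to
  them, and part of one link becomes a stem. So one induction step pays for two descents. A descent
  costs \<open>l + 2\<close> levels: 2 to find subtrees avoiding \<open>a\<close> and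
  \<open>b\<close>, and \<open>l\<close> for a possible \<open>bin_tree_plus l\<close>. With
  \<open>i = j = l\<close> this gives \<open>1 + (l + l) * (2 * (l + 2))\<close>, where the summand
  1 keeps two vertices in the last subtree. Connected sets replace paths throughout. A nonempty set
  is connected if no nonempty proper subset is closed under \<open>E\<close>, so most arguments
  follow an edge that leaves a set.\<close>

definition connected_on :: "('a \<Rightarrow> 'a \<Rightarrow> bool) \<Rightarrow> 'a set \<Rightarrow> bool" where
  "connected_on E S \<longleftrightarrow>
     S \<noteq> {} \<and> (\<forall>X \<subseteq> S. X \<noteq> {} \<longrightarrow> (\<forall>x \<in> X. \<forall>y \<in> S. E x y \<longrightarrow> y \<in> X) \<longrightarrow> X = S)"

definition biconnected_on :: "('a \<Rightarrow> 'a \<Rightarrow> bool) \<Rightarrow> 'a set \<Rightarrow> bool" where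
  "biconnected_on E S \<longleftrightarrow>
     (\<exists>x \<in> S. \<exists>y \<in> S. x \<noteq> y) \<and> connected_on E S \<and> (\<forall>v \<in> S. connected_on E (S - {v}))"

lemma connected_onD:
  assumes "connected_on E S" "X \<subseteq> S" "X \<noteq> {}" "\<And>x y. x \<in> X \<Longrightarrow> y \<in> S \<Longrightarrow> E x y \<Longrightarrow> y \<in> X"
  shows "X = S"
  using assms unfolding connected_on_def by blast

lemma connected_onI:
  assumes "S \<noteq> {}"
    and "\<And>X. X \<subseteq> S \<Longrightarrow> X \<noteq> {} \<Longrightarrow> (\<And>x y. x \<in> X \<Longrightarrow> y \<in> S \<Longrightarrow> E x y \<Longrightarrow> y \<in> X) \<Longrightarrow> X = S"
  shows "connected_on E S"
  using assms unfolding connected_on_def by blast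

lemma connected_on_nonempty: "connected_on E S \<Longrightarrow> S \<noteq> {}"
  by (simp add: connected_on_def)

lemma connected_on_singleton [simp]: "connected_on E {x}"
  by (rule connected_onI) auto

lemma connected_on_exit:
  assumes "connected_on E S" "X \<subseteq> S" "X \<noteq> {}" "X \<noteq> S"
  obtains x y where "x \<in> X" "y \<in> S" "y \<notin> X" "E x y"
  using connected_onD[OF assms(1-3)] assms(4) by blast

lemma biconnected_on_connected: "biconnected_on E S \<Longrightarrow> connected_on E S"
  by (simp add: biconnected_on_def)

lemma biconnected_on_Diff: "biconnected_on E S \<Longrightarrow> connected_on E (S - {v})"
  by (cases "v \<in> S") (simp_all add: biconnected_on_def)

locale symmetric_relation =
  fixes E :: "'a \<Rightarrow> 'a \<Rightarrow> bool"
  assumes E_sym: "E x y \<Longrightarrow> E y x"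
begin

abbreviation conn :: "'a set \<Rightarrow> bool" where "conn \<equiv> connected_on E"
abbreviation biconn :: "'a set \<Rightarrow> bool" where "biconn \<equiv> biconnected_on E"

text \<open>If \<open>X\<close> is closed in \<open>S\<close>, so is \<open>S - X\<close> by
  symmetry of \<open>E\<close>. Were both nonempty, both would meet \<open>T\<close>, while a closed
  set that meets the connected set \<open>T\<close> contains all of it.\<close>

lemma conn_if_meets:
  assumes T: "conn T" "T \<subseteq> S"
    and meets: "\<And>X. X \<subseteq> S \<Longrightarrow> X \<noteq> {} \<Longrightarrow> (\<And>x y. x \<in> X \<Longrightarrow> y \<in> S \<Longrightarrow> E x y \<Longrightarrow> y \<in> X) \<Longrightarrow> X \<inter> T \<noteq> {}"
  shows "conn S"
proof (rule connected_onI)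
  show "S \<noteq> {}" using T connected_on_nonempty by blast
next
  fix X assume X: "X \<subseteq> S" "X \<noteq> {}" "\<And>x y. x \<in> X \<Longrightarrow> y \<in> S \<Longrightarrow> E x y \<Longrightarrow> y \<in> X"
  have "X \<inter> T = T"
    using meets[OF X] X T by (intro connected_onD[OF T(1)]) auto
  moreover have "(S - X) \<inter> T \<noteq> {}" if "S - X \<noteq> {}"
    using X E_sym that by (intro meets) auto
  ultimately show "X = S" using X by blast
qed

lemma conn_Un_edge:
  assumes "conn A" "conn B" "x \<in> A" "y \<in> B" "E x y"
  shows "conn (A \<union> B)"
proof (rule conn_if_meets[OF assms(1)])
  fix X assume X: "X \<subseteq> A \<union> B" "X \<noteq> {}" "\<And>x y. x \<in> X \<Longrightarrow> y \<in> A \<union> B \<Longrightarrow> E x y \<Longrightarrow> y \<in> X"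
  show "X \<inter> A \<noteq> {}"
  proof
    assume "X \<inter> A = {}"
    then have "X = B" using X by (intro connected_onD[OF assms(2)]) auto
    then show False using X(3)[of y x] assms \<open>X \<inter> A = {}\<close> E_sym by blast
  qed
qed auto

lemma conn_Un:
  assumes "conn A" "conn B" "A \<inter> B \<noteq> {}"
  shows "conn (A \<union> B)"
proof (rule conn_if_meets[OF assms(1)])
  fix X assume X: "X \<subseteq> A \<union> B" "X \<noteq> {}" "\<And>x y. x \<in> X \<Longrightarrow> y \<in> A \<union> B \<Longrightarrow> E x y \<Longrightarrow> y \<in> X"
  show "X \<inter> A \<noteq> {}"
  proof
    assume "X \<inter> A = {}"
    then have "X = B" using X by (intro connected_onD[OF assms(2)]) auto
    then show False using assms \<open>X \<inter> A = {}\<close> by blast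
  qed
qed auto

lemma conn_insert: "conn A \<Longrightarrow> x \<in> A \<Longrightarrow> E x y \<Longrightarrow> conn (insert y A)"
  using conn_Un_edge[of A "{y}" x y] by simp

text \<open>The union of all connected sets between \<open>K\<close> and \<open>S\<close> works: it
  is connected because every member contains \<open>K\<close>, and closed because a neighbour can be
  added to any member.\<close>

lemma component:
  assumes "conn K" "K \<subseteq> S"
  obtains C where "K \<subseteq> C" "C \<subseteq> S" "conn C" "\<And>x y. x \<in> C \<Longrightarrow> y \<in> S \<Longrightarrow> E x y \<Longrightarrow> y \<in> C"
proof
  let ?F = "{C. K \<subseteq> C \<and> C \<subseteq> S \<and> conn C}"
  show "K \<subseteq> \<Union>?F" "\<Union>?F \<subseteq> S" using assms by auto
  show "conn (\<Union>?F)"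
  proof (rule conn_if_meets[OF assms(1)])
    fix X assume X: "X \<subseteq> \<Union>?F" "X \<noteq> {}" "\<And>x y. x \<in> X \<Longrightarrow> y \<in> \<Union>?F \<Longrightarrow> E x y \<Longrightarrow> y \<in> X"
    from \<open>X \<noteq> {}\<close> obtain x where "x \<in> X" by blast
    with X(1) obtain C where C: "x \<in> X" "x \<in> C" "C \<in> ?F" by (meson UnionE subsetD)
    have "X \<inter> C = C"
    proof (rule connected_onD[of E C])
      fix x y assume "x \<in> X \<inter> C" "y \<in> C" "E x y"
      then show "y \<in> X \<inter> C" using X(3)[of x y] C(3) by blast
    qed (use C in auto)
    then show "X \<inter> K \<noteq> {}" using C connected_on_nonempty[OF assms(1)] by blast
  qed (use assms in auto)
  fix x y assume "x \<in> \<Union>?F" "y \<in> S" "E x y"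
  then obtain C where "x \<in> C" "C \<in> ?F" by blast
  then have "insert y C \<in> ?F" using conn_insert \<open>y \<in> S\<close> \<open>E x y\<close> by blast
  then show "y \<in> \<Union>?F" by blast
qed

text \<open>The component \<open>C\<close> of \<open>S - T\<close> is not all of \<open>S\<close>,
  so some edge leaves it inside \<open>S\<close>; as \<open>C\<close> is closed in
  \<open>S - T\<close>, that edge ends in \<open>T\<close>. This replaces following a path up to its
  first vertex in \<open>T\<close>.\<close>

lemma component_exit:
  assumes "conn K" "K \<subseteq> S - T" "conn S" "S \<inter> T \<noteq> {}"
  obtains C x t where "K \<subseteq> C" "C \<subseteq> S - T" "conn C" "x \<in> C" "t \<in> S \<inter> T" "E x t"
    "\<And>x y. x \<in> C \<Longrightarrow> y \<in> S - T \<Longrightarrow> E x y \<Longrightarrow> y \<in> C"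
proof -
  obtain C where C: "K \<subseteq> C" "C \<subseteq> S - T" "conn C" "\<And>x y. x \<in> C \<Longrightarrow> y \<in> S - T \<Longrightarrow> E x y \<Longrightarrow> y \<in> C"
    using component[OF assms(1,2)] by metis
  have "C \<noteq> {}" "C \<subseteq> S" "C \<noteq> S" using C assms connected_on_nonempty[OF assms(1)] by auto
  then obtain x t where "x \<in> C" "t \<in> S" "t \<notin> C" "E x t"
    using connected_on_exit[OF assms(3)] by metis
  moreover from this C(4) have "t \<in> T" by blast
  ultimately show ?thesis by (intro that[OF C(1-3) _ _ _ C(4)]) auto
qed

lemma component_exit_vertex:
  assumes "k \<in> S" "k \<noteq> q" "conn S" "q \<in> S"
  obtains C x where "k \<in> C" "C \<subseteq> S - {q}" "conn C" "x \<in> C" "E x q"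
proof -
  have "conn {k}" "{k} \<subseteq> S - {q}" "S \<inter> {q} \<noteq> {}" using assms by auto
  from component_exit[OF this(1,2) \<open>conn S\<close> this(3)] obtain C x t where
    "{k} \<subseteq> C" "C \<subseteq> S - {q}" "conn C" "x \<in> C" "t \<in> S \<inter> {q}" "E x t" by metis
  then show ?thesis by (intro that[of C x]) auto
qed

text \<open>Stands for cutting a path from \<open>a\<close> at its first vertex in \<open>A\<close>:
  take the component of \<open>a\<close> in \<open>P - A\<close> and one neighbour in
  \<open>A\<close>. The last conclusion keeps the part before \<open>u\<close> available; rerouting
  a link and forming a stem both rely on it.\<close>

lemma truncate:
  assumes "conn P" "a \<in> P" "P \<inter> A \<noteq> {}"
  obtains Q u where "Q \<subseteq> P" "conn Q" "a \<in> Q" "Q \<inter> A = {u}"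
    "a \<notin> A \<Longrightarrow> conn (Q - {u}) \<and> (\<exists>x \<in> Q - {u}. E x u)"
proof (cases "a \<in> A")
  case True
  with assms show ?thesis by (intro that[of "{a}" a]) auto
next
  case False
  with assms have "conn {a}" "{a} \<subseteq> P - A" by auto
  then obtain C x t where C: "{a} \<subseteq> C" "C \<subseteq> P - A" "conn C" "x \<in> C" "t \<in> P \<inter> A" "E x t"
    using component_exit[OF _ _ assms(1,3)] by metis
  then have "insert t C \<inter> A = {t}" "insert t C - {t} = C" by auto
  then show ?thesis using C conn_insert by (intro that[of "insert t C" t]) auto
qed

section \<open>Two disjoint linkages\<close>

text \<open>Menger's theorem for two disjoint links is proved by moving one end along an edge from
  \<open>x\<close> to \<open>y\<close>. Repair is needed only if \<open>y\<close> lies in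
  \<open>P'\<close>. Removing \<open>y\<close> may then cut \<open>x'\<close> off from
  \<open>c'\<close>, and \<open>x'\<close> is reconnected inside \<open>V - {y}\<close>, which is
  connected because \<open>V\<close> is 2-connected.\<close>

lemma linkage_step:
  assumes V: "biconn V" and P: "conn P" "P \<subseteq> V" "c \<in> P" "x \<in> P"
    and P': "conn P'" "P' \<subseteq> V" "c' \<in> P'" "x' \<in> P'"
    and "P \<inter> P' = {}" and y: "y \<in> V" "y \<noteq> x'" "E x y"
  obtains Q Q' where "conn Q" "Q \<subseteq> V" "c \<in> Q" "conn Q'" "Q' \<subseteq> V" "c' \<in> Q'" "Q \<inter> Q' = {}"
    "y \<in> Q \<and> x' \<in> Q' \<or> x' \<in> Q \<and> y \<in> Q'"
proof -
  have Py: "conn (insert y P)" using conn_insert[OF P(1,4)] y by simp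
  have Vy: "conn (V - {y})" using V by (rule biconnected_on_Diff)
  consider "y \<notin> P'" | "y \<in> P'" "c' = y" | "y \<in> P'" "c' \<noteq> y" by blast
  then show ?thesis
  proof cases
    case 1
    with Py assms show ?thesis by (intro that[of "insert y P" P']) auto
  next
    case 2
    have "conn {x'}" "{x'} \<subseteq> (V - {y}) - P" "(V - {y}) \<inter> P \<noteq> {}" using assms 2 by auto
    then obtain C z t where "{x'} \<subseteq> C" "C \<subseteq> (V - {y}) - P" "conn C" "z \<in> C" "t \<in> (V - {y}) \<inter> P" "E z t"
      using component_exit[OF _ _ Vy] by metis
    with conn_Un_edge[of C P z t] 2 assms show ?thesis by (intro that[of "C \<union> P" "{y}"]) auto
  next
    case 3
    obtain D z where D: "c' \<in> D" "D \<subseteq> P' - {y}" "conn D" "z \<in> D" "E z y"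
      using component_exit_vertex[OF P'(3) 3(2) P'(1) 3(1)] .
    have Dy: "conn (insert y D)" using conn_insert D by blast
    show ?thesis
    proof (cases "x' \<in> D")
      case True
      with Py D assms 3 show ?thesis by (intro that[of "insert y P" D]) auto
    next
      case False
      have "conn {x'}" "{x'} \<subseteq> (V - {y}) - (P \<union> D)" "(V - {y}) \<inter> (P \<union> D) \<noteq> {}" using assms 3 False by auto
      then obtain C w t where C: "{x'} \<subseteq> C" "C \<subseteq> (V - {y}) - (P \<union> D)" "conn C" "w \<in> C"
          "t \<in> (V - {y}) \<inter> (P \<union> D)" "E w t"
        using component_exit[OF _ _ Vy] by metis
      \<comment> \<open>The first contact \<open>t\<close> decides which of \<open>P\<close> and
        \<open>D\<close> inherits \<open>x'\<close>; the other one receives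
        \<open>y\<close>.\<close>
      show ?thesis
      proof (cases "t \<in> P")
        case True
        with conn_Un_edge[of C P w t] C D Dy assms 3 show ?thesis
          by (intro that[of "C \<union> P" "insert y D"]) auto
      next
        case False
        with C have "t \<in> D" by blast
        with conn_Un_edge[of C D w t] C D Py assms 3 show ?thesis
          by (intro that[of "insert y P" "C \<union> D"]) auto
      qed
    qed
  qed
qed

text \<open>Which of \<open>x\<close>, \<open>x'\<close> is linked to \<open>a\<close> is left open,
  since a step may exchange the two ends.\<close>

definition linked :: "'a set \<Rightarrow> 'a \<Rightarrow> 'a \<Rightarrow> 'a \<Rightarrow> 'a \<Rightarrow> bool" where
  "linked V a a' x x' \<longleftrightarrow> (\<exists>P P'. conn P \<and> P \<subseteq> V \<and> a \<in> P \<and> conn P' \<and> P' \<subseteq> V \<and> a' \<in> P' \<and> P \<inter> P' = {} \<and>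
     (x \<in> P \<and> x' \<in> P' \<or> x' \<in> P \<and> x \<in> P'))"

lemma linked_commute: "linked V a a' x x' \<Longrightarrow> linked V a a' x' x"
  unfolding linked_def by blast

lemma linked_step:
  assumes V: "biconn V" and "linked V a a' x x'" "y \<in> V" "y \<noteq> x'" "E x y"
  shows "linked V a a' y x'"
proof -
  from assms(2) obtain P P' where P: "conn P" "P \<subseteq> V" "a \<in> P" "conn P'" "P' \<subseteq> V" "a' \<in> P'" "P \<inter> P' = {}"
    and or: "x \<in> P \<and> x' \<in> P' \<or> x' \<in> P \<and> x \<in> P'"
    unfolding linked_def by blast
  from or show ?thesis
  proof
    assume "x \<in> P \<and> x' \<in> P'"
    then obtain Q Q' where "conn Q" "Q \<subseteq> V" "a \<in> Q" "conn Q'" "Q' \<subseteq> V" "a' \<in> Q'" "Q \<inter> Q' = {}"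
      "y \<in> Q \<and> x' \<in> Q' \<or> x' \<in> Q \<and> y \<in> Q'"
      using linkage_step[OF V, of P a x P' a' x' y] P assms by metis
    then show ?thesis unfolding linked_def by blast
  next
    assume "x' \<in> P \<and> x \<in> P'"
    moreover have "P' \<inter> P = {}" using P by blast
    ultimately obtain Q Q' where "conn Q" "Q \<subseteq> V" "a' \<in> Q" "conn Q'" "Q' \<subseteq> V" "a \<in> Q'" "Q \<inter> Q' = {}"
      "y \<in> Q \<and> x' \<in> Q' \<or> x' \<in> Q \<and> y \<in> Q'"
      using linkage_step[OF V, of P' a' x P a x' y] P assms by metis
    moreover from this have "Q' \<inter> Q = {}" by blast
    ultimately show ?thesis unfolding linked_def by metis
  qed
qed

text \<open>The admissible positions of the moving end form a closed subset of
  \<open>V - {x'}\<close>, which is connected.\<close>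

lemma linked_move:
  assumes V: "biconn V" and l: "linked V a a' x x'" "x \<in> V" "x \<noteq> x'" and y: "y \<in> V" "y \<noteq> x'"
  shows "linked V a a' y x'"
proof -
  have "{z \<in> V - {x'}. linked V a a' z x'} = V - {x'}"
    using l linked_step[OF V] by (intro connected_onD[OF biconnected_on_Diff[OF V]]) auto
  with y show ?thesis by blast
qed

text \<open>Start from the trivial links \<open>{a}\<close> and \<open>{a'}\<close> and move the
  ends one at a time. The first end must not run into \<open>a'\<close>, so the target
  \<open>x = a'\<close> is reached with the two ends in exchanged roles.\<close>

lemma two_disjoint_links:
  assumes V: "biconn V" and "a \<in> V" "a' \<in> V" "a \<noteq> a'" "x \<in> V" "x' \<in> V" "x \<noteq> x'"
  shows "linked V a a' x x'"
proof -
  have "linked V a a' a a'"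
    unfolding linked_def using assms by (intro exI[of _ "{a}"] exI[of _ "{a'}"]) auto
  then have 1: "linked V a a' y a'" if "y \<in> V" "y \<noteq> a'" for y
    using linked_move[OF V, of a a' a a' y] assms that by blast
  show ?thesis
  proof (cases "x = a'")
    case True
    then show ?thesis using 1[of x'] linked_commute assms by metis
  next
    case False
    then have "linked V a a' a' x" using 1 assms linked_commute by blast
    then show ?thesis using linked_move[OF V, of a a' a' x x'] False assms linked_commute by metis
  qed
qed

lemma two_disjoint_paths_to_set:
  assumes V: "biconn V" and "a \<in> V" "b \<in> V" "a \<noteq> b" "T \<subseteq> V" "t \<in> T" "t' \<in> T" "t \<noteq> t'"
  obtains Q Q' q q' where "conn Q" "Q \<subseteq> V" "a \<in> Q" "conn Q'" "Q' \<subseteq> V" "b \<in> Q'" "Q \<inter> Q' = {}"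
    "Q \<inter> T = {q}" "Q' \<inter> T = {q'}"
    "a \<notin> T \<Longrightarrow> conn (Q - {q}) \<and> (\<exists>x \<in> Q - {q}. E x q)"
    "b \<notin> T \<Longrightarrow> conn (Q' - {q'}) \<and> (\<exists>x \<in> Q' - {q'}. E x q')"
proof -
  have "linked V a b t t'" using two_disjoint_links[OF V] assms by blast
  then obtain P P' where P: "conn P" "P \<subseteq> V" "a \<in> P" "conn P'" "P' \<subseteq> V" "b \<in> P'" "P \<inter> P' = {}"
    "t \<in> P \<and> t' \<in> P' \<or> t' \<in> P \<and> t \<in> P'"
    unfolding linked_def by blast
  then have ne: "P \<inter> T \<noteq> {}" "P' \<inter> T \<noteq> {}" using assms by auto
  obtain Q q where Q: "Q \<subseteq> P" "conn Q" "a \<in> Q" "Q \<inter> T = {q}" "a \<notin> T \<Longrightarrow> conn (Q - {q}) \<and> (\<exists>x \<in> Q - {q}. E x q)"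
    using truncate[OF P(1,3) ne(1)] by metis
  obtain Q' q' where Q': "Q' \<subseteq> P'" "conn Q'" "b \<in> Q'" "Q' \<inter> T = {q'}"
    "b \<notin> T \<Longrightarrow> conn (Q' - {q'}) \<and> (\<exists>x \<in> Q' - {q'}. E x q')"
    using truncate[OF P(4,6) ne(2)] by metis
  have "Q \<inter> Q' = {}" "Q \<subseteq> V" "Q' \<subseteq> V" using P Q(1) Q'(1) by auto
  then show ?thesis using Q(2-5) Q'(2-5) by (intro that[of Q Q' q q'])
qed

section \<open>Thin connections\<close>

text \<open>A minimal connected set containing \<open>u\<close> and \<open>v\<close> is the vertex set of an induced \<open>u\<close>-\<open>v\<close> path.\<close>

definition thin :: "'a set \<Rightarrow> 'a \<Rightarrow> 'a \<Rightarrow> bool" where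
  "thin R u v \<longleftrightarrow> conn R \<and> u \<in> R \<and> v \<in> R \<and> (\<forall>S \<subseteq> R. conn S \<longrightarrow> u \<in> S \<longrightarrow> v \<in> S \<longrightarrow> S = R)"

lemma thinD:
  assumes "thin R u v"
  shows "conn R" "u \<in> R" "v \<in> R" "\<And>S. S \<subseteq> R \<Longrightarrow> conn S \<Longrightarrow> u \<in> S \<Longrightarrow> v \<in> S \<Longrightarrow> S = R"
  using assms unfolding thin_def by auto

lemma thin_commute: "thin R u v \<Longrightarrow> thin R v u"
  unfolding thin_def by blast

lemma ex_thin:
  assumes "finite P" "conn P" "u \<in> P" "v \<in> P"
  obtains R where "R \<subseteq> P" "thin R u v"
proof -
  have "\<exists>R \<subseteq> P. thin R u v"
    using assms
  proof (induction P rule: finite_psubset_induct)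
    case (psubset P)
    show ?case
    proof (cases "thin P u v")
      case False
      then obtain S where "S \<subset> P" "conn S" "u \<in> S" "v \<in> S" using psubset.prems unfolding thin_def by blast
      then show ?thesis using psubset.IH[of S] by blast
    qed blast
  qed
  then show ?thesis using that by blast
qed

text \<open>Adding \<open>u\<close> to the component of \<open>v\<close> in \<open>R - {u}\<close>
  connects \<open>u\<close> with \<open>v\<close>, so by minimality it is all of
  \<open>R\<close>.\<close>

lemma thin_remove_end:
  assumes R: "thin R u v" and "u \<noteq> v"
  shows "conn (R - {u})"
proof -
  note thin = thinD[OF R]
  obtain C x where C: "v \<in> C" "C \<subseteq> R - {u}" "conn C" "x \<in> C" "E x u"
    using component_exit_vertex[OF thin(3) _ thin(1,2)] \<open>u \<noteq> v\<close> by metis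
  then have "insert u C = R" using conn_insert thin(2) by (intro thin(4)) auto
  then have "C = R - {u}" using C by blast
  then show ?thesis using C by simp
qed

text \<open>Minimality makes the two sides \<open>K\<close> and \<open>L\<close> of \<open>q\<close>
  disjoint, since otherwise their union would connect \<open>u\<close> and \<open>v\<close> without
  \<open>q\<close>, and it makes them cover everything but \<open>q\<close>. Then \<open>q\<close>
  joins the side that does not contain \<open>q'\<close>.\<close>

lemma thin_split:
  assumes R: "thin R u v" and "u \<noteq> v" and q: "q \<in> R" "q' \<in> R" "q \<noteq> q'"
  obtains R1 R2 where "conn R1" "conn R2" "R1 \<inter> R2 = {}" "R1 \<union> R2 = R" "u \<in> R1" "v \<in> R2"
    "q \<in> R1 \<and> q' \<in> R2 \<or> q' \<in> R1 \<and> q \<in> R2"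
proof -
  note thin = thinD[OF R]
  consider "q = u" | "q = v" | "q \<noteq> u" "q \<noteq> v" by blast
  then show ?thesis
  proof cases
    case 1
    then show ?thesis
      using thin_remove_end[OF R \<open>u \<noteq> v\<close>] thin(1-3) assms by (intro that[of "{u}" "R - {u}"]) auto
  next
    case 2
    then show ?thesis
      using thin_remove_end[OF thin_commute[OF R]] thin(1-3) assms by (intro that[of "R - {v}" "{v}"]) auto
  next
    case 3
    obtain K x where K: "u \<in> K" "K \<subseteq> R - {q}" "conn K" "x \<in> K" "E x q"
      using component_exit_vertex[OF thin(2) 3(1)[symmetric] thin(1) q(1)] .
    obtain L y where L: "v \<in> L" "L \<subseteq> R - {q}" "conn L" "y \<in> L" "E y q"
      using component_exit_vertex[OF thin(3) 3(2)[symmetric] thin(1) q(1)] .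
    have K': "conn (insert q K)" and L': "conn (insert q L)" using K L conn_insert by auto
    have "insert q K \<union> L = R"
      using conn_Un_edge[OF K' L(3) _ L(4) E_sym[OF L(5)]] K L q by (intro thin(4)) auto
    moreover have "K \<inter> L = {}"
    proof (rule ccontr)
      assume "K \<inter> L \<noteq> {}"
      then have "K \<union> L = R" using conn_Un K L by (intro thin(4)) auto
      then show False using K L q by blast
    qed
    ultimately consider "q' \<in> L" "insert q K \<union> L = R" "K \<inter> L = {}" | "q' \<in> K" "insert q K \<union> L = R" "K \<inter> L = {}"
      using q by blast
    then show ?thesis
    proof cases
      case 1
      then show ?thesis using K L K' q by (intro that[of "insert q K" L]) auto
    next
      case 2
      then show ?thesis using K L L' q by (intro that[of K "insert q L"]) auto
    qed
  qed
qed

section \<open>Thetas and cycles through two vertex sets\<close>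

text \<open>Two disjoint induced paths between \<open>W1\<close> and \<open>W2\<close> with
  interiors outside both: the frame to which \<open>a\<close> and \<open>b\<close> get
  attached.\<close>

definition ladder ::
    "'a set \<Rightarrow> 'a set \<Rightarrow> 'a set \<Rightarrow> 'a set \<Rightarrow> 'a \<Rightarrow> 'a \<Rightarrow> 'a set \<Rightarrow> 'a \<Rightarrow> 'a \<Rightarrow> bool" where
  "ladder V W1 W2 R u v R' u' v' \<longleftrightarrow>
     W1 \<subseteq> V \<and> W2 \<subseteq> V \<and> W1 \<inter> W2 = {} \<and> R \<subseteq> V \<and> R' \<subseteq> V \<and> R \<inter> R' = {} \<and> thin R u v \<and> thin R' u' v' \<and>
     R \<inter> W1 = {u} \<and> R \<inter> W2 = {v} \<and> R' \<inter> W1 = {u'} \<and> R' \<inter> W2 = {v'}"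

lemma ladderD:
  assumes "ladder V W1 W2 R u v R' u' v'"
  shows "W1 \<subseteq> V" "W2 \<subseteq> V" "W1 \<inter> W2 = {}" "R \<subseteq> V" "R' \<subseteq> V" "R \<inter> R' = {}" "thin R u v" "thin R' u' v'"
    "R \<inter> W1 = {u}" "R \<inter> W2 = {v}" "R' \<inter> W1 = {u'}" "R' \<inter> W2 = {v'}" "u \<noteq> v" "u' \<noteq> v'"
    "conn R" "conn R'"
proof -
  note l = assms[unfolded ladder_def]
  from l show "W1 \<subseteq> V" "W2 \<subseteq> V" "W1 \<inter> W2 = {}" "R \<subseteq> V" "R' \<subseteq> V" "R \<inter> R' = {}" "thin R u v" "thin R' u' v'"
    "R \<inter> W1 = {u}" "R \<inter> W2 = {v}" "R' \<inter> W1 = {u'}" "R' \<inter> W2 = {v'}"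
    by simp_all
  then show "u \<noteq> v" "u' \<noteq> v'" by auto
  from l show "conn R" "conn R'" by (simp_all add: thin_def)
qed

lemma ladder_swap: "ladder V W1 W2 R u v R' u' v' \<Longrightarrow> ladder V W1 W2 R' u' v' R u v"
  unfolding ladder_def by auto

lemma ladder_flip: "ladder V W1 W2 R u v R' u' v' \<Longrightarrow> ladder V W2 W1 R v u R' v' u'"
  unfolding ladder_def using thin_commute by auto

text \<open>The set is cut first at \<open>W2\<close> and then, starting back from \<open>v\<close>,
  at \<open>W1\<close>. The second cut only shrinks it, so the contact with \<open>W2\<close> stays
  unique.\<close>

lemma ex_thin_between:
  assumes "finite P" "conn P" "a \<in> P" "a \<in> W1" "x \<in> P" "x \<in> W2"
  obtains R u v where "R \<subseteq> P" "thin R u v" "R \<inter> W1 = {u}" "R \<inter> W2 = {v}"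
proof -
  have "P \<inter> W2 \<noteq> {}" using assms by blast
  then obtain Q v where Q: "Q \<subseteq> P" "conn Q" "a \<in> Q" "Q \<inter> W2 = {v}"
    using truncate[OF assms(2,3)] by metis
  have "v \<in> Q" "Q \<inter> W1 \<noteq> {}" using Q assms by auto
  then obtain S u where S: "S \<subseteq> Q" "conn S" "v \<in> S" "S \<inter> W1 = {u}"
    using truncate[OF Q(2)] by metis
  have "finite S" using S(1) Q(1) assms(1) by (meson finite_subset)
  then obtain R where R: "R \<subseteq> S" "thin R u v"
    using ex_thin[of S u v] S by (metis Int_iff insertI1)
  have "u \<in> R" "v \<in> R" using thinD[OF R(2)] by auto
  with Q(1,4) S(1,4) R show ?thesis by (intro that[of R u v]) auto
qed

lemma ex_ladder:
  assumes V: "biconn V" "finite V" and W: "W1 \<subseteq> V" "W2 \<subseteq> V" "W1 \<inter> W2 = {}"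
    and two: "a \<in> W1" "a' \<in> W1" "a \<noteq> a'" "x \<in> W2" "x' \<in> W2" "x \<noteq> x'"
  obtains R u v R' u' v' where "ladder V W1 W2 R u v R' u' v'"
proof -
  have "linked V a a' x x'" using two_disjoint_links[OF V(1)] assms by blast
  then obtain P P' where P: "conn P" "P \<subseteq> V" "a \<in> P" "conn P'" "P' \<subseteq> V" "a' \<in> P'" "P \<inter> P' = {}"
    "x \<in> P \<and> x' \<in> P' \<or> x' \<in> P \<and> x \<in> P'"
    unfolding linked_def by blast
  have fin: "finite P" "finite P'" using P V finite_subset by auto
  obtain y y' where y: "y \<in> P" "y \<in> W2" "y' \<in> P'" "y' \<in> W2" using P(8) two by blast
  obtain R u v where "R \<subseteq> P" "thin R u v" "R \<inter> W1 = {u}" "R \<inter> W2 = {v}"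
    using ex_thin_between[OF fin(1) P(1,3) two(1) y(1,2)] by metis
  moreover obtain R' u' v' where "R' \<subseteq> P'" "thin R' u' v'" "R' \<inter> W1 = {u'}" "R' \<inter> W2 = {v'}"
    using ex_thin_between[OF fin(2) P(4,6) two(2) y(3,4)] by metis
  ultimately have "ladder V W1 W2 R u v R' u' v'"
    using W P(2,5,7) unfolding ladder_def by auto
  then show ?thesis by (rule that)
qed

text \<open>
  In both types \<open>W1\<close> and \<open>W2\<close> can be traversed between two distinct vertices: side by side, each
  joined to \<open>a\<close> and to \<open>b\<close>, or one after the other along an \<open>a\<close>-\<open>b\<close> path. In the cycle type the edge
  between \<open>X\<close> and \<open>Z\<close> yields the root edge of the next \<open>nabla\<close>.
\<close>

definition theta_type :: "'a set \<Rightarrow> 'a \<Rightarrow> 'a \<Rightarrow> 'a set \<Rightarrow> 'a set \<Rightarrow> bool" where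
  "theta_type V a b W1 W2 \<longleftrightarrow> (\<exists>X Y x1 x2 y1 y2. conn X \<and> conn Y \<and> X \<subseteq> V \<and> Y \<subseteq> V \<and> X \<inter> Y = {} \<and> a \<in> X \<and> b \<in> Y \<and>
     X \<inter> W1 = {x1} \<and> X \<inter> W2 = {x2} \<and> Y \<inter> W1 = {y1} \<and> Y \<inter> W2 = {y2})"

definition cycle_type :: "'a set \<Rightarrow> 'a \<Rightarrow> 'a \<Rightarrow> 'a set \<Rightarrow> 'a set \<Rightarrow> bool" where
  "cycle_type V a b W1 W2 \<longleftrightarrow> (\<exists>X Y Z x y1 y2 z. conn X \<and> conn Y \<and> conn Z \<and> X \<subseteq> V \<and> Y \<subseteq> V \<and> Z \<subseteq> V \<and>
     X \<inter> Y = {} \<and> X \<inter> Z = {} \<and> Y \<inter> Z = {} \<and> a \<in> X \<and> b \<in> Z \<and> (\<exists>p \<in> X. \<exists>q \<in> Z. E p q) \<and>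
     X \<inter> W1 = {x} \<and> X \<inter> W2 = {} \<and> Y \<inter> W1 = {y1} \<and> Y \<inter> W2 = {y2} \<and> Z \<inter> W1 = {} \<and> Z \<inter> W2 = {z})"

lemma theta_typeI:
  assumes "conn X" "conn Y" "X \<subseteq> V" "Y \<subseteq> V" "X \<inter> Y = {}" "a \<in> X" "b \<in> Y"
     "X \<inter> W1 = {x1}" "X \<inter> W2 = {x2}" "Y \<inter> W1 = {y1}" "Y \<inter> W2 = {y2}"
  shows "theta_type V a b W1 W2"
  unfolding theta_type_def by (intro exI conjI; fact)

lemma cycle_typeI:
  assumes "conn X" "conn Y" "conn Z" "X \<subseteq> V" "Y \<subseteq> V" "Z \<subseteq> V"
    "X \<inter> Y = {}" "X \<inter> Z = {}" "Y \<inter> Z = {}" "a \<in> X" "b \<in> Z" "p \<in> X" "q \<in> Z" "E p q"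
    "X \<inter> W1 = {x}" "X \<inter> W2 = {}" "Y \<inter> W1 = {y1}" "Y \<inter> W2 = {y2}" "Z \<inter> W1 = {}" "Z \<inter> W2 = {z}"
  shows "cycle_type V a b W1 W2"
  unfolding cycle_type_def by (intro exI conjI bexI; fact)

lemma theta_typeE:
  assumes "theta_type V a b W1 W2"
  obtains X Y x1 x2 y1 y2 where "conn X" "conn Y" "X \<subseteq> V" "Y \<subseteq> V" "X \<inter> Y = {}" "a \<in> X" "b \<in> Y"
     "X \<inter> W1 = {x1}" "X \<inter> W2 = {x2}" "Y \<inter> W1 = {y1}" "Y \<inter> W2 = {y2}"
  using assms unfolding theta_type_def by (elim exE conjE) (rule that)

lemma cycle_typeE:
  assumes "cycle_type V a b W1 W2"
  obtains X Y Z p q x y1 y2 z where "conn X" "conn Y" "conn Z" "X \<subseteq> V" "Y \<subseteq> V" "Z \<subseteq> V"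
    "X \<inter> Y = {}" "X \<inter> Z = {}" "Y \<inter> Z = {}" "a \<in> X" "b \<in> Z" "p \<in> X" "q \<in> Z" "E p q"
    "X \<inter> W1 = {x}" "X \<inter> W2 = {}" "Y \<inter> W1 = {y1}" "Y \<inter> W2 = {y2}" "Z \<inter> W1 = {}" "Z \<inter> W2 = {z}"
  using assms unfolding cycle_type_def by (elim exE conjE bexE) (rule that)

lemma theta_type_commute: "theta_type V a b W1 W2 \<Longrightarrow> theta_type V b a W1 W2"
  unfolding theta_type_def by (metis inf_commute)

lemma theta_type_flip: "theta_type V a b W1 W2 \<Longrightarrow> theta_type V a b W2 W1"
  unfolding theta_type_def by metis

lemma cycle_type_reverse:
  assumes "cycle_type V a b W1 W2"
  shows "cycle_type V b a W2 W1"
proof -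
  from assms obtain X Y Z p q x y1 y2 z where c: "conn X" "conn Y" "conn Z" "X \<subseteq> V" "Y \<subseteq> V" "Z \<subseteq> V"
    "X \<inter> Y = {}" "X \<inter> Z = {}" "Y \<inter> Z = {}" "a \<in> X" "b \<in> Z" "p \<in> X" "q \<in> Z" "E p q"
    "X \<inter> W1 = {x}" "X \<inter> W2 = {}" "Y \<inter> W1 = {y1}" "Y \<inter> W2 = {y2}" "Z \<inter> W1 = {}" "Z \<inter> W2 = {z}"
    by (rule cycle_typeE)
  have "Z \<inter> Y = {}" "Z \<inter> X = {}" "Y \<inter> X = {}" "E q p" using c(7-9,14) E_sym by auto
  then show ?thesis using c(1-6,10-13,15-20)
    by (intro cycle_typeI[of Z Y X V b a q p W2 z W1 y2 y1 x])
qed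

section \<open>Case analysis over the landing points of \<open>a\<close> and \<open>b\<close> on a
  ladder\<close>

definition theta_or_cycle :: "'a set \<Rightarrow> 'a \<Rightarrow> 'a \<Rightarrow> 'a set \<Rightarrow> 'a set \<Rightarrow> bool" where
  "theta_or_cycle V a b W1 W2 \<longleftrightarrow> theta_type V a b W1 W2 \<or> cycle_type V a b W1 W2 \<or> cycle_type V a b W2 W1"

text \<open>Reversing a cycle exchanges \<open>a\<close>, \<open>b\<close> and also
  \<open>W1\<close>, \<open>W2\<close>; with both orders of \<open>W1\<close>, \<open>W2\<close>
  allowed in the definition, each exchange alone is a symmetry, which cuts down the cases
  below.\<close>

lemma theta_or_cycle_commute: "theta_or_cycle V b a W1 W2 \<Longrightarrow> theta_or_cycle V a b W1 W2"
  unfolding theta_or_cycle_def using theta_type_commute cycle_type_reverse by metis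

lemma theta_or_cycle_flip: "theta_or_cycle V a b W2 W1 \<Longrightarrow> theta_or_cycle V a b W1 W2"
  unfolding theta_or_cycle_def using theta_type_flip by metis

text \<open>In the applications \<open>T\<close> is the vertex set of a ladder and \<open>Q\<close>,
  \<open>Q'\<close> are the links from \<open>a\<close> and \<open>b\<close> to it; the cases below
  differ in where the landing points \<open>q\<close> and \<open>q'\<close> lie.\<close>

definition attached ::
    "'a set \<Rightarrow> 'a set \<Rightarrow> 'a \<Rightarrow> 'a \<Rightarrow> 'a set \<Rightarrow> 'a set \<Rightarrow> 'a \<Rightarrow> 'a \<Rightarrow> bool" where
  "attached V T a b Q Q' q q' \<longleftrightarrow> conn Q \<and> conn Q' \<and> Q \<subseteq> V \<and> Q' \<subseteq> V \<and> Q \<inter> Q' = {} \<and> a \<in> Q \<and> b \<in> Q' \<and>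
     Q \<inter> T = {q} \<and> Q' \<inter> T = {q'}"

lemma attachedD:
  assumes "attached V T a b Q Q' q q'"
  shows "conn Q" "conn Q'" "Q \<subseteq> V" "Q' \<subseteq> V" "Q \<inter> Q' = {}" "a \<in> Q" "b \<in> Q'"
    "Q \<inter> T = {q}" "Q' \<inter> T = {q'}"
  using assms unfolding attached_def by auto

lemma attached_Int:
  assumes "attached V T a b Q Q' q q'" "S \<subseteq> T"
  shows "Q \<inter> S = (if q \<in> S then {q} else {})" "S \<inter> Q = (if q \<in> S then {q} else {})"
    "Q' \<inter> S = (if q' \<in> S then {q'} else {})" "S \<inter> Q' = (if q' \<in> S then {q'} else {})"
proof -
  have *: "A \<inter> S = (if x \<in> S then {x} else {})" if "A \<inter> T = {x}" for A x
  proof -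
    have "A \<inter> S = (A \<inter> T) \<inter> S" using assms(2) by blast
    then show ?thesis unfolding that by simp
  qed
  show "Q \<inter> S = (if q \<in> S then {q} else {})" "Q' \<inter> S = (if q' \<in> S then {q'} else {})"
    using * attachedD(8,9)[OF assms(1)] by metis+
  then show "S \<inter> Q = (if q \<in> S then {q} else {})" "S \<inter> Q' = (if q' \<in> S then {q'} else {})"
    by (simp_all add: Int_commute)
qed

lemma ladder_mem:
  assumes "ladder V W1 W2 R u v R' u' v'"
  shows "x \<in> R \<Longrightarrow> x \<in> W1 \<longleftrightarrow> x = u" "x \<in> R \<Longrightarrow> x \<in> W2 \<longleftrightarrow> x = v"
    "x \<in> R' \<Longrightarrow> x \<in> W1 \<longleftrightarrow> x = u'" "x \<in> R' \<Longrightarrow> x \<in> W2 \<longleftrightarrow> x = v'"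
    "x \<in> R \<Longrightarrow> x \<notin> R'" "x \<in> R' \<Longrightarrow> x \<notin> R" "x \<in> W1 \<Longrightarrow> x \<notin> W2" "x \<in> W2 \<Longrightarrow> x \<notin> W1"
  using ladderD(3,6,9-12)[OF assms] by (metis Int_iff insertI1 singletonD empty_iff)+

text \<open>Phrased as rewrite rules so that, after distributing with \<open>Int_Un\<close>,
  \<open>simp\<close> computes the intersections in each configuration from the memberships of
  \<open>q\<close> and \<open>q'\<close>.\<close>

lemma ladder_attached_Int:
  assumes "ladder V W1 W2 R u v R' u' v'" "attached V (R \<union> R' \<union> W1 \<union> W2) a b Q Q' q q'"
  shows "Q \<inter> R = (if q \<in> R then {q} else {})" "R \<inter> Q = (if q \<in> R then {q} else {})"
    "Q' \<inter> R = (if q' \<in> R then {q'} else {})" "R \<inter> Q' = (if q' \<in> R then {q'} else {})"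
    "Q \<inter> R' = (if q \<in> R' then {q} else {})" "R' \<inter> Q = (if q \<in> R' then {q} else {})"
    "Q' \<inter> R' = (if q' \<in> R' then {q'} else {})" "R' \<inter> Q' = (if q' \<in> R' then {q'} else {})"
    "Q \<inter> W1 = (if q \<in> W1 then {q} else {})" "Q' \<inter> W1 = (if q' \<in> W1 then {q'} else {})"
    "Q \<inter> W2 = (if q \<in> W2 then {q} else {})" "Q' \<inter> W2 = (if q' \<in> W2 then {q'} else {})"
    "Q \<inter> Q' = {}" "Q' \<inter> Q = {}" "R \<inter> R' = {}" "R' \<inter> R = {}"
    "R \<inter> W1 = {u}" "R \<inter> W2 = {v}" "R' \<inter> W1 = {u'}" "R' \<inter> W2 = {v'}"
  using attached_Int[OF assms(2), of R] attached_Int[OF assms(2), of R'] attached_Int[OF assms(2), of W1]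
    attached_Int[OF assms(2), of W2] attachedD(5)[OF assms(2)] ladderD(6,9-12)[OF assms(1)]
  by (simp_all add: Int_commute Un_upper1 le_supI1)

lemmas Int_Un = Int_Un_distrib Int_Un_distrib2

lemma attached_commute: "attached V T a b Q Q' q q' \<Longrightarrow> attached V T b a Q' Q q' q"
  unfolding attached_def by auto

text \<open>Landing points on different rails give a theta, each link taking its rail. If they share
  a rail, it is split between them: its pieces extend the links to \<open>X\<close> and
  \<open>Z\<close>, and the other rail serves as \<open>Y\<close>.\<close>

lemma theta_or_cycle_rails:
  assumes lad: "ladder V W1 W2 R u v R' u' v'"
    and att: "attached V (R \<union> R' \<union> W1 \<union> W2) a b Q Q' q q'"
    and "q \<in> R \<union> R'" "q' \<in> R \<union> R'"
  shows "theta_or_cycle V a b W1 W2"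
proof -
  have *: "theta_or_cycle V a b W1 W2"
    if lad: "ladder V W1 W2 R u v R' u' v'" and att: "attached V (R \<union> R' \<union> W1 \<union> W2) a b Q Q' q q'"
      and q: "q \<in> R" "q' \<in> R \<union> R'" for R u v R' u' v'
  proof (cases "q' \<in> R'")
    case True
    note l = ladderD[OF lad] and t = attachedD[OF att] and I = ladder_attached_Int[OF lad att]
    note m = ladder_mem(1,2,5)[OF lad q(1)] ladder_mem(3,4,6)[OF lad True]
    have "conn (Q \<union> R)" "conn (Q' \<union> R')"
      using conn_Un[OF t(1) l(15)] conn_Un[OF t(2) l(16)] q(1) True by (simp_all add: I)
    then have "theta_type V a b W1 W2"
    proof (rule theta_typeI)
      show "(Q \<union> R) \<inter> (Q' \<union> R') = {}" "(Q \<union> R) \<inter> W1 = {u}" "(Q \<union> R) \<inter> W2 = {v}"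
        "(Q' \<union> R') \<inter> W1 = {u'}" "(Q' \<union> R') \<inter> W2 = {v'}"
        by (simp_all add: Int_Un I m)
    qed (use l(4,5) t(3,4,6,7) in auto)
    then show ?thesis unfolding theta_or_cycle_def by blast
  next
    case False
    note l = ladderD[OF lad] and t = attachedD[OF att] and I = ladder_attached_Int[OF lad att]
    have q': "q' \<in> R" using False q by blast
    note m = ladder_mem(1,2,5)[OF lad q(1)] ladder_mem(1,2,5)[OF lad q']
    have "q \<noteq> q'" using t(5,8,9) by blast
    then obtain R1 R2 where R: "conn R1" "conn R2" "R1 \<inter> R2 = {}" "R1 \<union> R2 = R" "u \<in> R1" "v \<in> R2"
      and or: "q \<in> R1 \<and> q' \<in> R2 \<or> q' \<in> R1 \<and> q \<in> R2"
      using thin_split[OF l(7,13) q(1) q'] by metis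
    have Int_part: "A \<inter> S = (A \<inter> R) \<inter> S" "S \<inter> A = (A \<inter> R) \<inter> S" if "S \<subseteq> R" for A S using that by auto
    have sub: "R1 \<subseteq> R" "R2 \<subseteq> R" and RR: "R2 \<inter> R1 = {}" "v \<notin> R1" "u \<notin> R2" using R by auto
    have "R1 \<inter> W1 = R1 \<inter> {u}" "R1 \<inter> W2 = R1 \<inter> {v}" "R2 \<inter> W1 = R2 \<inter> {u}" "R2 \<inter> W2 = R2 \<inter> {v}"
      using Int_part(1)[OF sub(1), of W1] Int_part(1)[OF sub(1), of W2]
        Int_part(1)[OF sub(2), of W1] Int_part(1)[OF sub(2), of W2] I(17,18) by (simp_all add: Int_commute)
    then have P: "R1 \<inter> W1 = {u}" "R1 \<inter> W2 = {}" "R2 \<inter> W1 = {}" "R2 \<inter> W2 = {v}" using R RR by auto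
    have "Q \<inter> R1 = {q} \<inter> R1" "Q' \<inter> R1 = {q'} \<inter> R1" "Q \<inter> R2 = {q} \<inter> R2" "Q' \<inter> R2 = {q'} \<inter> R2"
      using Int_part(1)[OF sub(1), of Q] Int_part(1)[OF sub(1), of Q']
        Int_part(1)[OF sub(2), of Q] Int_part(1)[OF sub(2), of Q'] I(1,3) q(1) q' by simp_all
    moreover have "R1 \<inter> R' = {}" "R2 \<inter> R' = {}" "R' \<inter> R1 = {}" "R' \<inter> R2 = {}" using sub l(6) by auto
    ultimately have P': "Q \<inter> R1 = {q} \<inter> R1" "Q' \<inter> R1 = {q'} \<inter> R1" "Q \<inter> R2 = {q} \<inter> R2" "Q' \<inter> R2 = {q'} \<inter> R2"
      "R1 \<inter> Q' = {q'} \<inter> R1" "R2 \<inter> Q' = {q'} \<inter> R2"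
      "R1 \<inter> R' = {}" "R2 \<inter> R' = {}" "R' \<inter> R1 = {}" "R' \<inter> R2 = {}" by (simp_all add: Int_commute)
    \<comment> \<open>An edge across the split of \<open>R\<close> is the chord required by the
      cycle type.\<close>
    have "R1 \<noteq> {}" "R1 \<noteq> R" using R by blast+
    then obtain x y where e: "x \<in> R1" "y \<in> R2" "E x y"
      using connected_on_exit[of E R R1] l(15) R(4) by blast
    from or show ?thesis
    proof
      assume qq: "q \<in> R1 \<and> q' \<in> R2"
      then have "q \<notin> R2" "q' \<notin> R1" "q \<noteq> v" "q' \<noteq> u" using R(3) RR by auto
      note n = this qq
      from qq have "conn (Q \<union> R1)" "conn (Q' \<union> R2)" using R t by (auto intro!: conn_Un)
      then have "cycle_type V a b W1 W2"
      proof (intro cycle_typeI)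
        show "(Q \<union> R1) \<inter> R' = {}" "(Q \<union> R1) \<inter> (Q' \<union> R2) = {}" "R' \<inter> (Q' \<union> R2) = {}"
          "(Q \<union> R1) \<inter> W1 = {u}" "(Q \<union> R1) \<inter> W2 = {}" "(Q' \<union> R2) \<inter> W1 = {}" "(Q' \<union> R2) \<inter> W2 = {v}"
          "R' \<inter> W1 = {u'}" "R' \<inter> W2 = {v'}"
          by (simp_all add: Int_Un I P P' m n R(3))
        show "x \<in> Q \<union> R1" "y \<in> Q' \<union> R2" "E x y" using e by auto
      qed (use l(4,5,16) t(3,4,6,7) sub in auto)
      then show ?thesis unfolding theta_or_cycle_def by blast
    next
      assume qq: "q' \<in> R1 \<and> q \<in> R2"
      then have "q \<notin> R1" "q' \<notin> R2" "q \<noteq> u" "q' \<noteq> v" using R(3) RR by auto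
      note n = this qq
      from qq have "conn (Q \<union> R2)" "conn (Q' \<union> R1)" using R t by (auto intro!: conn_Un)
      then have "cycle_type V a b W2 W1"
      proof (intro cycle_typeI)
        show "(Q \<union> R2) \<inter> R' = {}" "(Q \<union> R2) \<inter> (Q' \<union> R1) = {}" "R' \<inter> (Q' \<union> R1) = {}"
          "(Q \<union> R2) \<inter> W1 = {}" "(Q \<union> R2) \<inter> W2 = {v}" "(Q' \<union> R1) \<inter> W1 = {u}" "(Q' \<union> R1) \<inter> W2 = {}"
          "R' \<inter> W1 = {u'}" "R' \<inter> W2 = {v'}"
          by (simp_all add: Int_Un I P P' m n RR)
        show "y \<in> Q \<union> R2" "x \<in> Q' \<union> R1" "E y x" using e E_sym by auto
      qed (use l(4,5,16) t(3,4,6,7) sub in auto)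
      then show ?thesis unfolding theta_or_cycle_def by blast
    qed
  qed
  show ?thesis
  proof (cases "q \<in> R")
    case True
    then show ?thesis using *[OF lad att] assms by blast
  next
    case False
    have "attached V (R' \<union> R \<union> W1 \<union> W2) a b Q Q' q q'" using att by (simp add: Un_commute)
    then show ?thesis using *[OF ladder_swap[OF lad]] False assms by blast
  qed
qed

text \<open>Since \<open>a\<close> is outside \<open>W1\<close> and \<open>V - W1\<close> is
  connected, a second way \<open>L\<close> leads from \<open>a\<close> to the ladder outside
  \<open>W1\<close> or to \<open>Q'\<close>. Its first contact \<open>s\<close> decides: on
  \<open>Q'\<close> or on the rail of \<open>q'\<close> it yields the chord of a cycle, on the other
  rail or in \<open>W2\<close> a theta.\<close>

lemma theta_or_cycle_end_rail:
  assumes lad: "ladder V W1 W2 R u v R' u' v'"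
    and att: "attached V (R \<union> R' \<union> W1 \<union> W2) a b Q Q' q q'"
    and W1: "conn (V - W1)" "a \<notin> W1" and q: "q \<in> W1" "q' \<in> R \<union> R'" "q' \<notin> W1"
  shows "theta_or_cycle V a b W1 W2"
proof -
  have *: "theta_or_cycle V a b W1 W2"
    if lad: "ladder V W1 W2 R u v R' u' v'" and att: "attached V (R \<union> R' \<union> W1 \<union> W2) a b Q Q' q q'"
      and q': "q' \<in> R" and qR: "q \<notin> R" "q \<notin> R'" for R u v R' u' v'
  proof -
    let ?T = "R \<union> R' \<union> W1 \<union> W2"
    note l = ladderD[OF lad] and t = attachedD[OF att] and I = ladder_attached_Int[OF lad att]
    note m = ladder_mem(1,2,5)[OF lad q'] ladder_mem(7)[OF lad q(1)] q(1,3) q' qR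
    have "a \<noteq> q" using W1 q by blast
    then have "conn {a}" "{a} \<subseteq> (V - W1) - (?T \<union> Q')" "(V - W1) \<inter> (?T \<union> Q') \<noteq> {}"
      using t q(3) by auto
    then obtain L x s where L: "{a} \<subseteq> L" "L \<subseteq> (V - W1) - (?T \<union> Q')" "conn L" "x \<in> L"
        "s \<in> (V - W1) \<inter> (?T \<union> Q')" "E x s"
      using component_exit[OF _ _ W1(1)] by metis
    have LI: "L \<inter> R = {}" "L \<inter> R' = {}" "L \<inter> W1 = {}" "L \<inter> W2 = {}" "L \<inter> Q' = {}" "L \<subseteq> V" using L(2) by auto
    have s: "s \<in> V" "s \<notin> W1" using L(5) by auto
    have QL: "conn (Q \<union> L)" using conn_Un[OF t(1) L(3)] t(6) L(1) by auto
    have QR: "conn (Q' \<union> R)" using conn_Un[OF t(2) l(15)] q' by (simp add: I)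
    consider "s \<in> Q' \<union> R" | "s \<in> R'" "s \<notin> Q' \<union> R" | "s \<in> W2" "s \<notin> Q' \<union> R" "s \<notin> R'"
      using L(5) by blast
    then show ?thesis
    proof cases
      case 1
      \<comment> \<open>The vertex \<open>u\<close> is dropped from the rail because
        \<open>Z\<close> has to avoid \<open>W1\<close>; neither \<open>q'\<close> nor
        \<open>s\<close> is \<open>u\<close>.\<close>
      have n: "q' \<noteq> u" using q' q(3) l(9) by blast
      then have "conn (Q' \<union> (R - {u}))"
        using thin_remove_end[OF l(7,13)] t q' by (auto intro!: conn_Un)
      moreover have "s \<noteq> u" using s l(9) by blast
      ultimately have "s \<in> Q' \<union> (R - {u})" "conn (Q' \<union> (R - {u}))" using 1 by auto
      with QL l(16) have "cycle_type V a b W1 W2"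
      proof (intro cycle_typeI)
        have sub: "A \<inter> R = {} \<Longrightarrow> A \<inter> (R - {u}) = {}" for A by blast
        have "(R - {u}) \<inter> W1 = R \<inter> W1 - {u}" "(R - {u}) \<inter> W2 = R \<inter> W2 - {u}" by auto
        then have "(R - {u}) \<inter> W1 = {}" "(R - {u}) \<inter> W2 = {v}" using I(17,18) l(13) by auto
        then show "(Q \<union> L) \<inter> R' = {}" "(Q \<union> L) \<inter> (Q' \<union> (R - {u})) = {}" "R' \<inter> (Q' \<union> (R - {u})) = {}"
          "(Q \<union> L) \<inter> W1 = {q}" "(Q \<union> L) \<inter> W2 = {}" "(Q' \<union> (R - {u})) \<inter> W1 = {}" "(Q' \<union> (R - {u})) \<inter> W2 = {v}"
          by (simp_all add: Int_Un I LI m n sub)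
        show "x \<in> Q \<union> L" "E x s" using L(4,6) by auto
        show "R' \<inter> W1 = {u'}" "R' \<inter> W2 = {v'}" using l(11,12) by auto
      qed (use l(4,5) t(3,4,6,7) LI(6) in auto)
      then show ?thesis unfolding theta_or_cycle_def by blast
    next
      case 2
      \<comment> \<open>\<open>Q\<close> is left out: with it the set would meet \<open>W1\<close>
        in \<open>q\<close> besides \<open>u'\<close>.\<close>
      have "conn (L \<union> R')" using conn_Un_edge[OF L(3) l(16) L(4) 2(1) L(6)] .
      with QR have "theta_type V a b W1 W2"
      proof (intro theta_typeI)
        show "(L \<union> R') \<inter> (Q' \<union> R) = {}" "(L \<union> R') \<inter> W1 = {u'}" "(L \<union> R') \<inter> W2 = {v'}"
          "(Q' \<union> R) \<inter> W1 = {u}" "(Q' \<union> R) \<inter> W2 = {v}"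
          using m by (simp_all add: Int_Un I LI)
      qed (use l(4,5) t(3,4,6,7) L(1) LI(6) in auto)
      then show ?thesis unfolding theta_or_cycle_def by blast
    next
      case 3
      have "conn (insert s (Q \<union> L))" using conn_insert[OF QL] L by blast
      with QR have "theta_type V a b W1 W2"
      proof (intro theta_typeI)
        show "insert s (Q \<union> L) \<inter> (Q' \<union> R) = {}" "insert s (Q \<union> L) \<inter> W1 = {q}" "insert s (Q \<union> L) \<inter> W2 = {s}"
          "(Q' \<union> R) \<inter> W1 = {u}" "(Q' \<union> R) \<inter> W2 = {v}"
          using m 3 s by (simp_all add: Int_Un I LI)
      qed (use l(4,5) t(3,4,6,7) LI(6) s in auto)
      then show ?thesis unfolding theta_or_cycle_def by blast
    qed
  qed
  show ?thesis
  proof (cases "q \<in> R \<union> R'")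
    case True
    then show ?thesis using theta_or_cycle_rails[OF lad att] q by blast
  next
    case qR: False
    show ?thesis
    proof (cases "q' \<in> R")
      case True
      then show ?thesis using *[OF lad att] qR by blast
    next
      case False
      have "attached V (R' \<union> R \<union> W1 \<union> W2) a b Q Q' q q'" using att by (simp add: Un_commute)
      then show ?thesis using *[OF ladder_swap[OF lad]] qR False q by blast
    qed
  qed
qed

text \<open>Landing points on a rail are covered by the previous lemma and its mirror image.
  Otherwise \<open>a\<close> escapes from \<open>W1\<close> as before: contact with
  \<open>Q'\<close> gives a cycle with a rail as \<open>Y\<close>, and contact with a rail outside
  \<open>W2\<close> gives a new landing point there. Only if \<open>a\<close> reaches
  \<open>W2\<close> must \<open>b\<close> escape from \<open>W2\<close> as well.\<close>

lemma theta_or_cycle_ends: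
  assumes lad: "ladder V W1 W2 R u v R' u' v'"
    and att: "attached V (R \<union> R' \<union> W1 \<union> W2) a b Q Q' q q'"
    and W1: "conn (V - W1)" "a \<notin> W1" and W2: "conn (V - W2)" "b \<notin> W2" and q: "q \<in> W1" "q' \<in> W2"
  shows "theta_or_cycle V a b W1 W2"
proof -
  let ?T = "R \<union> R' \<union> W1 \<union> W2"
  note l = ladderD[OF lad] and t = attachedD[OF att] and I = ladder_attached_Int[OF lad att]
  have flip: "?T = R \<union> R' \<union> W2 \<union> W1" by blast
  have end_rail': "theta_or_cycle V a b W1 W2"
    if "attached V ?T a b P Q' p q'" "p \<in> R \<union> R'" "p \<notin> W2" for P p
  proof -
    have "attached V (R \<union> R' \<union> W2 \<union> W1) b a Q' P q' p"
      using attached_commute[OF that(1)] unfolding flip .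
    then have "theta_or_cycle V b a W2 W1"
      using theta_or_cycle_end_rail[OF ladder_flip[OF lad] _ W2] that q by blast
    then show ?thesis using theta_or_cycle_commute theta_or_cycle_flip by blast
  qed
  have q12: "q \<notin> W2" "q' \<notin> W1" using q l(3) by auto
  consider "q \<in> R \<union> R'" | "q' \<in> R \<union> R'" | "q \<notin> R \<union> R'" "q' \<notin> R \<union> R'" by blast
  then show ?thesis
  proof cases
    case 1
    then show ?thesis using end_rail'[OF att] q12 by blast
  next
    case 2
    then show ?thesis using theta_or_cycle_end_rail[OF lad att W1] q q12 by blast
  next
    case 3
    then have m: "q \<notin> R" "q \<notin> R'" "q' \<notin> R" "q' \<notin> R'" "q \<in> W1" "q' \<in> W2" "q \<notin> W2" "q' \<notin> W1" using q q12 by auto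
    have "a \<noteq> q" using W1 q by blast
    then have "conn {a}" "{a} \<subseteq> (V - W1) - (?T \<union> Q')" "(V - W1) \<inter> (?T \<union> Q') \<noteq> {}"
      using t q q12 W1 by auto
    then obtain L x s where L: "{a} \<subseteq> L" "L \<subseteq> (V - W1) - (?T \<union> Q')" "conn L" "x \<in> L"
        "s \<in> (V - W1) \<inter> (?T \<union> Q')" "E x s"
      using component_exit[OF _ _ W1(1)] by metis
    have LI: "L \<inter> R = {}" "L \<inter> R' = {}" "L \<inter> W1 = {}" "L \<inter> W2 = {}" "L \<inter> Q' = {}" "L \<subseteq> V" using L(2) by auto
    have s: "s \<in> V" "s \<notin> W1" using L(5) by auto
    have QL: "conn (Q \<union> L)" using conn_Un[OF t(1) L(3)] t(6) L(1) by auto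
    have sL: "conn (insert s L)" and sQL: "conn (insert s (Q \<union> L))"
      using conn_insert[OF L(3,4,6)] conn_insert[OF QL _ L(6)] L(4) by auto
    consider "s \<in> Q'" | "s \<notin> Q'" "s \<in> W2" | "s \<notin> Q'" "s \<in> R \<union> R'" "s \<notin> W2" using L(5) by blast
    then show ?thesis
    proof cases
      case 1
      with QL l(15) t(2) have "cycle_type V a b W1 W2"
      proof (intro cycle_typeI)
        show "(Q \<union> L) \<inter> R = {}" "(Q \<union> L) \<inter> Q' = {}" "R \<inter> Q' = {}"
          "(Q \<union> L) \<inter> W1 = {q}" "(Q \<union> L) \<inter> W2 = {}" "Q' \<inter> W1 = {}" "Q' \<inter> W2 = {q'}"
          "R \<inter> W1 = {u}" "R \<inter> W2 = {v}"
          using m by (simp_all add: Int_Un I LI)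
        show "x \<in> Q \<union> L" "E x s" using L(4,6) by auto
      qed (use l(4,5) t(3,4,6,7) LI(6) in auto)
      then show ?thesis unfolding theta_or_cycle_def by blast
    next
      case 2
      let ?X = "insert s (Q \<union> L)"
      have "b \<noteq> q'" using W2 q by blast
      then have "conn {b}" "{b} \<subseteq> (V - W2) - (?T \<union> ?X)" "(V - W2) \<inter> (?T \<union> ?X) \<noteq> {}"
        using t q q12 W2 2 L(2) by auto
      then obtain L' x' s' where L': "{b} \<subseteq> L'" "L' \<subseteq> (V - W2) - (?T \<union> ?X)" "conn L'" "x' \<in> L'"
          "s' \<in> (V - W2) \<inter> (?T \<union> ?X)" "E x' s'"
        using component_exit[OF _ _ W2(1)] by metis
      have L'I: "R \<inter> L' = {}" "L' \<inter> W1 = {}" "L' \<inter> W2 = {}" "Q \<inter> L' = {}" "L \<inter> L' = {}" "s \<notin> L'" "L' \<subseteq> V"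
        using L'(2) by auto
      have s'V: "s' \<in> V" "s' \<notin> W2" using L'(5) by auto
      have QL': "conn (Q' \<union> L')" using conn_Un[OF t(2) L'(3)] t(7) L'(1) by auto
      consider "s' \<in> ?X" | "s' \<notin> ?X" "s' \<in> W1" | "s' \<notin> ?X" "s' \<in> R \<union> R'" "s' \<notin> W1" using L'(5) by blast
      then show ?thesis
      proof cases
        case 1
        \<comment> \<open>The contact is not \<open>s\<close>, which lies in \<open>W2\<close>; so
          \<open>s\<close> can be left out again and \<open>X\<close> avoids
          \<open>W2\<close>.\<close>
        then have "s' \<in> Q \<union> L" using s'V 2 by auto
        with QL l(15) QL' have "cycle_type V a b W1 W2"
        proof (intro cycle_typeI)
          show "(Q \<union> L) \<inter> R = {}" "(Q \<union> L) \<inter> (Q' \<union> L') = {}" "R \<inter> (Q' \<union> L') = {}"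
            "(Q \<union> L) \<inter> W1 = {q}" "(Q \<union> L) \<inter> W2 = {}" "(Q' \<union> L') \<inter> W1 = {}" "(Q' \<union> L') \<inter> W2 = {q'}"
            "R \<inter> W1 = {u}" "R \<inter> W2 = {v}"
            using m by (simp_all add: Int_Un I LI L'I)
          show "x' \<in> Q' \<union> L'" "E s' x'" using L'(4) E_sym[OF L'(6)] by auto
        qed (use l(4,5) t(3,4,6,7) LI(6) L'I(7) in auto)
        then show ?thesis unfolding theta_or_cycle_def by blast
      next
        case s': 2
        have "conn (insert s' (Q' \<union> L'))" using conn_insert[OF QL'] L' by blast
        with sQL have "theta_type V a b W1 W2"
        proof (intro theta_typeI)
          show "?X \<inter> insert s' (Q' \<union> L') = {}" "?X \<inter> W1 = {q}" "?X \<inter> W2 = {s}"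
            "insert s' (Q' \<union> L') \<inter> W1 = {s'}" "insert s' (Q' \<union> L') \<inter> W2 = {q'}"
            using m s s' s'V 2 by (simp_all add: Int_Un I LI L'I)
        qed (use t(3,4,6,7) LI(6) L'I(7) s s'V in auto)
        then show ?thesis unfolding theta_or_cycle_def by blast
      next
        case s': 3
        have "conn (insert s' L')" using conn_insert[OF L'(3,4,6)] .
        moreover have "insert s' L' \<inter> ?T = {s'}" using L'(2) s'(2) by blast
        ultimately have "attached V ?T a b Q (insert s' L') q s'"
          using t(1,3,6,8) s' L'(1) L'I(4,7) s'V(1) unfolding attached_def by auto
        then show ?thesis using theta_or_cycle_end_rail[OF lad _ W1 q(1)] s' by blast
      qed
    next
      case s': 3
      have "insert s L \<inter> ?T = {s}" using L(2) s'(2) by blast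
      then have "attached V ?T a b (insert s L) Q' s q'"
        using t(2,4,7,9) s s' sL L(1) LI(5,6) unfolding attached_def by auto
      then show ?thesis using end_rail' s' by blast
    qed
  qed
qed

text \<open>The two exchange symmetries reduce the seven positions of the landing points to the
  three cases above.\<close>

lemma theta_or_cycle_separate:
  assumes lad: "ladder V W1 W2 R u v R' u' v'"
    and att: "attached V (R \<union> R' \<union> W1 \<union> W2) a b Q Q' q q'"
    and W1: "conn (V - W1)" and W2: "conn (V - W2)" and ab: "a \<notin> W1 \<union> W2" "b \<notin> W1 \<union> W2"
    and q: "\<not> (q \<in> W1 \<and> q' \<in> W1)" "\<not> (q \<in> W2 \<and> q' \<in> W2)"
  shows "theta_or_cycle V a b W1 W2"
proof -
  have flip: "R \<union> R' \<union> W1 \<union> W2 = R \<union> R' \<union> W2 \<union> W1" by blast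
  have "q \<in> R \<union> R' \<union> W1 \<union> W2" "q' \<in> R \<union> R' \<union> W1 \<union> W2" using attachedD(8,9)[OF att] by auto
  then consider "q \<in> R \<union> R'" "q' \<in> R \<union> R'" | "q \<in> W1" "q' \<in> W2" | "q \<in> W2" "q' \<in> W1"
    | "q \<in> W1" "q' \<in> R \<union> R'" | "q \<in> W2" "q' \<in> R \<union> R'" | "q' \<in> W1" "q \<in> R \<union> R'" | "q' \<in> W2" "q \<in> R \<union> R'"
    using q by blast
  then show ?thesis
  proof cases
    case 1
    then show ?thesis using theta_or_cycle_rails[OF lad att] by blast
  next
    case 2
    then show ?thesis using theta_or_cycle_ends[OF lad att W1 _ W2] ab by blast
  next
    case 3
    then show ?thesis
      using theta_or_cycle_ends[OF ladder_flip[OF lad] att[unfolded flip] W2 _ W1] ab theta_or_cycle_flip by blast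
  next
    case 4
    then show ?thesis using theta_or_cycle_end_rail[OF lad att W1] ab q by blast
  next
    case 5
    then show ?thesis
      using theta_or_cycle_end_rail[OF ladder_flip[OF lad] att[unfolded flip] W2] ab q theta_or_cycle_flip by blast
  next
    case 6
    then show ?thesis
      using theta_or_cycle_end_rail[OF lad attached_commute[OF att] W1] ab q theta_or_cycle_commute by blast
  next
    case 7
    then show ?thesis
      using theta_or_cycle_end_rail[OF ladder_flip[OF lad] attached_commute[OF att[unfolded flip]] W2] ab q
        theta_or_cycle_flip theta_or_cycle_commute by blast
  qed
qed

text \<open>Both links end in \<open>W\<close>, but their parts before \<open>W\<close> lie in the
  connected set \<open>V - W\<close>, which also meets the rest of \<open>T\<close>. Hence one of
  them can be rerouted to reach \<open>T\<close> outside \<open>W\<close>.\<close>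

lemma detach_from_end:
  assumes V: "conn (V - W)" and T: "W \<subseteq> T" "(V - W) \<inter> T \<noteq> {}"
    and att: "attached V T a b Q Q' q q'" and q: "q \<in> W" "q' \<in> W"
    and K: "a \<in> Q - {q}" "b \<in> Q' - {q'}" "conn (Q - {q})" "conn (Q' - {q'})"
  obtains P s where "s \<notin> W" "attached V T a b P Q' s q'" | P s where "s \<notin> W" "attached V T a b Q P q s"
proof -
  note t = attachedD[OF att]
  let ?A = "Q - {q}" and ?B = "Q' - {q'}"
  have sub: "?A \<subseteq> V - W - (T \<union> ?B)" "?B \<subseteq> V - W - (T \<union> ?A)" using t(3-9) T by auto
  obtain L where L: "?A \<subseteq> L" "L \<subseteq> V - W - (T \<union> ?B)" "conn L"
    "\<And>x y. x \<in> L \<Longrightarrow> y \<in> V - W - (T \<union> ?B) \<Longrightarrow> E x y \<Longrightarrow> y \<in> L"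
    using component[OF K(3) sub(1)] by metis
  obtain L' where L': "?B \<subseteq> L'" "L' \<subseteq> V - W - (T \<union> ?A)" "conn L'"
    "\<And>x y. x \<in> L' \<Longrightarrow> y \<in> V - W - (T \<union> ?A) \<Longrightarrow> E x y \<Longrightarrow> y \<in> L'"
    using component[OF K(4) sub(2)] by metis
  have "L \<union> L' \<subseteq> V - W" "L \<union> L' \<noteq> {}" "L \<union> L' \<noteq> V - W" using L L' T(2) K by auto
  then obtain x s where x: "x \<in> L \<union> L'" "s \<in> V - W" "s \<notin> L \<union> L'" "E x s"
    using connected_on_exit[OF V] by metis
  \<comment> \<open>Besides \<open>T\<close>, the set \<open>L\<close> was only told to avoid
    \<open>?B\<close>, which is part of \<open>L'\<close>, and vice versa; so an edge leaving the
    union of \<open>L\<close> and \<open>L'\<close> cannot end outside \<open>T\<close>.\<close>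
  have s: "s \<in> T"
  proof (rule ccontr)
    assume "s \<notin> T"
    from x(1) show False
    proof
      assume "x \<in> L"
      then show False using L(4)[OF _ _ x(4)] L'(1) x(2,3) \<open>s \<notin> T\<close> by blast
    next
      assume "x \<in> L'"
      then show False using L'(4)[OF _ _ x(4)] L(1) x(2,3) \<open>s \<notin> T\<close> by blast
    qed
  qed
  from x(1) show ?thesis
  proof
    assume "x \<in> L"
    then have "attached V T a b (insert s L) Q' s q'"
      using conn_insert[OF L(3) _ x(4)] t(2-9) L(1,2) s x(2) K(1) q(2)
      unfolding attached_def by auto
    then show ?thesis using that(1) x(2) by blast
  next
    assume "x \<in> L'"
    then have "attached V T a b Q (insert s L') q s"
      using conn_insert[OF L'(3) _ x(4)] t(1-9) L'(1,2) s x(2) K(2) q(1)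
      unfolding attached_def by auto
    then show ?thesis using that(2) x(2) by blast
  qed
qed

lemma theta_or_cycle:
  assumes V: "biconn V" "finite V" and W: "W1 \<subseteq> V" "W2 \<subseteq> V" "W1 \<inter> W2 = {}"
    and bi: "biconn W1" "biconn W2" and co: "conn (V - W1)" "conn (V - W2)"
    and ab: "a \<in> V" "b \<in> V" "a \<noteq> b" "a \<notin> W1 \<union> W2" "b \<notin> W1 \<union> W2"
  shows "theta_or_cycle V a b W1 W2"
proof -
  obtain w1 w1' w2 w2' where w: "w1 \<in> W1" "w1' \<in> W1" "w1 \<noteq> w1'" "w2 \<in> W2" "w2' \<in> W2" "w2 \<noteq> w2'"
    using bi unfolding biconnected_on_def by blast
  obtain R u v R' u' v' where lad: "ladder V W1 W2 R u v R' u' v'"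
    using ex_ladder[OF V W w] .
  note l = ladderD[OF lad]
  let ?T = "R \<union> R' \<union> W1 \<union> W2"
  have T: "?T \<subseteq> V" "w1 \<in> ?T" "w1' \<in> ?T" using l w by auto
  obtain Q Q' q q' where Q: "conn Q" "Q \<subseteq> V" "a \<in> Q" "conn Q'" "Q' \<subseteq> V" "b \<in> Q'" "Q \<inter> Q' = {}"
    "Q \<inter> ?T = {q}" "Q' \<inter> ?T = {q'}"
    "a \<notin> ?T \<Longrightarrow> conn (Q - {q}) \<and> (\<exists>x \<in> Q - {q}. E x q)"
    "b \<notin> ?T \<Longrightarrow> conn (Q' - {q'}) \<and> (\<exists>x \<in> Q' - {q'}. E x q')"
    using two_disjoint_paths_to_set[OF V(1) ab(1-3) T w(3)] by metis
  then have att: "attached V ?T a b Q Q' q q'" unfolding attached_def by auto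
  have sep: "theta_or_cycle V a b W1 W2"
    if "attached V ?T a b P P' p p'" "\<not> (p \<in> W1 \<and> p' \<in> W1)" "\<not> (p \<in> W2 \<and> p' \<in> W2)" for P P' p p'
    using theta_or_cycle_separate[OF lad that(1) co ab(4,5) that(2,3)] .
  have detach: "theta_or_cycle V a b W1 W2"
    if W: "W = W1 \<or> W = W2" and q: "q \<in> W" "q' \<in> W" for W
  proof -
    have "conn (V - W)" "W \<subseteq> ?T" "(V - W) \<inter> ?T \<noteq> {}"
      using W co l(1-3) w(1,4) by auto
    moreover have "a \<in> Q - {q}" "b \<in> Q' - {q'}" using Q(3,6) q W ab(4,5) by auto
    moreover from this have "a \<notin> ?T" "b \<notin> ?T" using Q(8,9) by auto
    then have "conn (Q - {q})" "conn (Q' - {q'})" using Q(10,11) by auto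
    ultimately consider P s where "s \<notin> W" "attached V ?T a b P Q' s q'" | P s where "s \<notin> W" "attached V ?T a b Q P q s"
      using detach_from_end[OF _ _ _ att q] by metis
    then show ?thesis
    proof cases
      case 1
      show ?thesis by (rule sep[OF 1(2)]) (use 1(1) W q l(3) in auto)
    next
      case 2
      show ?thesis by (rule sep[OF 2(2)]) (use 2(1) W q l(3) in auto)
    qed
  qed
  show ?thesis using sep[OF att] detach by blast
qed

section \<open>Two-connected subsets\<close>

text \<open>Pruning at a cut vertex \<open>v\<close> of \<open>A\<close> outside \<open>D\<close>:
  what is thrown away is joined to \<open>K\<close> only through \<open>v\<close>. It stays attached
  to \<open>V - A\<close>, as otherwise \<open>v\<close> would be a cut vertex of \<open>V\<close>,
  and it is of no help in connecting the rest of \<open>K\<close> to \<open>v\<close> after the loss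
  of some \<open>d\<close>.\<close>

lemma biconnected_core_step:
  assumes V: "biconn V" and A: "conn A" "A \<subseteq> V" "conn (V - A)" and D: "conn D" "D \<subseteq> A"
    and cut: "\<And>d. d \<in> D \<Longrightarrow> conn (A - {d})" and v: "v \<in> A" "v \<notin> D" "\<not> conn (A - {v})"
  obtains A' where "A' \<subset> A" "conn A'" "conn (V - A')" "D \<subseteq> A'" "\<And>d. d \<in> D \<Longrightarrow> conn (A' - {d})"
proof -
  have "D \<subseteq> A - {v}" using D v by blast
  then obtain K where K: "D \<subseteq> K" "K \<subseteq> A - {v}" "conn K"
    "\<And>x y. x \<in> K \<Longrightarrow> y \<in> A - {v} \<Longrightarrow> E x y \<Longrightarrow> y \<in> K"
    using component[OF D(1)] by metis
  let ?A = "insert v K"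
  let ?J = "A - ?A"
  have JK: "\<not> E x y" "\<not> E y x" if "x \<in> K" "y \<in> ?J" for x y using K(4)[of x y] that E_sym[of y x] by blast+
  have "K \<noteq> A - {v}" using K(3) v(3) by blast
  then have ne: "K \<noteq> {}" "K \<noteq> A" "K \<subseteq> A" "?A \<subset> A" using K connected_on_nonempty[OF K(3)] v(1) by auto
  obtain x y where xy: "x \<in> K" "y \<in> A" "y \<notin> K" "E x y"
    using connected_on_exit[OF A(1) ne(3,1,2)] .
  then have "y = v" using K(4)[of x y] by blast
  then have connA: "conn ?A" using conn_insert[OF K(3) xy(1)] xy(4) by simp
  have Vv: "conn (V - {v})" using V by (rule biconnected_on_Diff)
  have "conn (V - ?A)"
  proof (rule conn_if_meets[OF A(3)])
    fix X assume X: "X \<subseteq> V - ?A" "X \<noteq> {}" "\<And>x y. x \<in> X \<Longrightarrow> y \<in> V - ?A \<Longrightarrow> E x y \<Longrightarrow> y \<in> X"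
    show "X \<inter> (V - A) \<noteq> {}"
    proof
      assume "X \<inter> (V - A) = {}"
      then have "X \<subseteq> ?J" using X(1) by blast
      have "X = V - {v}"
      proof (rule connected_onD[OF Vv])
        fix x y assume "x \<in> X" "y \<in> V - {v}" "E x y"
        then show "y \<in> X" using X(3)[of x y] JK(2)[of y x] \<open>X \<subseteq> ?J\<close> by blast
      qed (use X in auto)
      moreover obtain k where "k \<in> K" using ne(1) by blast
      ultimately show False using \<open>X \<subseteq> ?J\<close> K(2) A(2) by blast
    qed
  qed (use ne in blast)
  moreover have "conn (?A - {d})" if d: "d \<in> D" for d
  proof (rule conn_if_meets[of "{v}"])
    show "{v} \<subseteq> ?A - {d}" using d v by blast
    fix X assume X: "X \<subseteq> ?A - {d}" "X \<noteq> {}" "\<And>x y. x \<in> X \<Longrightarrow> y \<in> ?A - {d} \<Longrightarrow> E x y \<Longrightarrow> y \<in> X"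
    show "X \<inter> {v} \<noteq> {}"
    proof
      assume "X \<inter> {v} = {}"
      then have "X \<subseteq> K" using X(1) by blast
      have "X = A - {d}"
      proof (rule connected_onD[OF cut[OF d]])
        fix x y assume "x \<in> X" "y \<in> A - {d}" "E x y"
        then show "y \<in> X" using X(3)[of x y] JK(1)[of x y] \<open>X \<subseteq> K\<close> by blast
      qed (use X \<open>X \<subseteq> K\<close> ne(3) in auto)
      then show False using \<open>X \<inter> {v} = {}\<close> v d by blast
    qed
  qed simp
  ultimately show ?thesis using that[of ?A] ne(4) connA K(1) by blast
qed

text \<open>Pruning ends because \<open>A\<close> shrinks while \<open>D\<close> survives; once no
  cut vertex is left, \<open>A\<close> is 2-connected, the vertices \<open>d1\<close> and
  \<open>d2\<close> ruling out a singleton.\<close>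

lemma biconnected_core:
  assumes V: "biconn V" and A: "finite A" "conn A" "A \<subseteq> V" "conn (V - A)"
    and D: "conn D" "D \<subseteq> A" "d1 \<in> D" "d2 \<in> D" "d1 \<noteq> d2"
    and cut: "\<And>d. d \<in> D \<Longrightarrow> conn (A - {d})"
  obtains U where "U \<subseteq> A" "D \<subseteq> U" "biconn U" "conn (V - U)"
proof -
  have "\<exists>U \<subseteq> A. D \<subseteq> U \<and> biconn U \<and> conn (V - U)"
    using A D(2) cut
  proof (induction A rule: finite_psubset_induct)
    case (psubset A)
    show ?case
    proof (cases "\<exists>v \<in> A - D. \<not> conn (A - {v})")
      case True
      then obtain v where "v \<in> A" "v \<notin> D" "\<not> conn (A - {v})" by blast
      then obtain A' where A': "A' \<subset> A" "conn A'" "conn (V - A')" "D \<subseteq> A'" "\<And>d. d \<in> D \<Longrightarrow> conn (A' - {d})"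
        using biconnected_core_step[OF V psubset.prems(1-3) D(1) psubset.prems(4,5)] by metis
      then have "A' \<subseteq> V" using psubset.prems(2) by blast
      then obtain U where "U \<subseteq> A'" "D \<subseteq> U" "biconn U" "conn (V - U)"
        using psubset.IH[OF A'(1,2) _ A'(3,4,5)] by blast
      then show ?thesis using A'(1) by blast
    next
      case False
      have "conn (A - {v})" if "v \<in> A" for v using False psubset.prems(5)[of v] that by blast
      then have "biconn A" unfolding biconnected_on_def using D(3-5) psubset.prems(1,4) by blast
      then show ?thesis using psubset.prems by blast
    qed
  qed
  then show ?thesis using that by blast
qed

text \<open>A part of \<open>D\<close> that \<open>d\<close> cuts off from \<open>A - D\<close>
  would have no edge to \<open>V - A\<close> either, so \<open>d\<close> would separate it in
  \<open>V\<close>.\<close>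

lemma conn_Diff_if_no_exit:
  assumes V: "biconn V" and A: "A \<subseteq> V" "V - A \<noteq> {}" and D: "D \<subseteq> A" "conn (A - D)" "d \<in> D"
    and no_exit: "\<And>x y. x \<in> D \<Longrightarrow> y \<in> V - A \<Longrightarrow> \<not> E x y"
  shows "conn (A - {d})"
proof (rule conn_if_meets[OF D(2)])
  fix X assume X: "X \<subseteq> A - {d}" "X \<noteq> {}" "\<And>x y. x \<in> X \<Longrightarrow> y \<in> A - {d} \<Longrightarrow> E x y \<Longrightarrow> y \<in> X"
  show "X \<inter> (A - D) \<noteq> {}"
  proof
    assume "X \<inter> (A - D) = {}"
    then have "X \<subseteq> D" using X(1) by blast
    have "X = V - {d}"
    proof (rule connected_onD[OF biconnected_on_Diff[OF V]])
      fix x y assume "x \<in> X" "y \<in> V - {d}" "E x y"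
      then show "y \<in> X" using X(3)[of x y] no_exit[of x y] \<open>X \<subseteq> D\<close> by blast
    qed (use X A in auto)
    then show False using \<open>X \<subseteq> D\<close> A D by blast
  qed
qed (use D in blast)

section \<open>Minor models inside a vertex set\<close>

text \<open>The notion \<open>minor_model\<close> relative to a vertex set, so that the induction
  can descend into subsets of one fixed graph.\<close>

definition model_in :: "'b pair_pre_digraph \<Rightarrow> 'a set \<Rightarrow> ('b \<Rightarrow> 'a set) \<Rightarrow> bool" where
  "model_in H W B \<longleftrightarrow>
     (\<forall>v \<in> pverts H. B v \<subseteq> W \<and> conn (B v)) \<and>
     (\<forall>u \<in> pverts H. \<forall>v \<in> pverts H. u \<noteq> v \<longrightarrow> B u \<inter> B v = {}) \<and>
     (\<forall>(u, v) \<in> parcs H. \<exists>x \<in> B u. \<exists>y \<in> B v. E x y)"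

lemma model_inD:
  assumes "model_in H W B"
  shows "v \<in> pverts H \<Longrightarrow> B v \<subseteq> W" "v \<in> pverts H \<Longrightarrow> conn (B v)"
    "u \<in> pverts H \<Longrightarrow> v \<in> pverts H \<Longrightarrow> u \<noteq> v \<Longrightarrow> B u \<inter> B v = {}"
    "(u, v) \<in> parcs H \<Longrightarrow> \<exists>x \<in> B u. \<exists>y \<in> B v. E x y"
  using assms unfolding model_in_def by blast+

lemma model_inI:
  assumes "\<And>v. v \<in> pverts H \<Longrightarrow> B v \<subseteq> W" "\<And>v. v \<in> pverts H \<Longrightarrow> conn (B v)"
    "\<And>u v p. u \<in> pverts H \<Longrightarrow> v \<in> pverts H \<Longrightarrow> p \<in> B u \<Longrightarrow> p \<in> B v \<Longrightarrow> u = v"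
    "\<And>u v. (u, v) \<in> parcs H \<Longrightarrow> \<exists>x \<in> B u. \<exists>y \<in> B v. E x y"
  shows "model_in H W B"
  unfolding model_in_def
proof (intro conjI ballI impI)
  fix u v assume "u \<in> pverts H" "v \<in> pverts H" "u \<noteq> v"
  then show "B u \<inter> B v = {}" using assms(3)[of u v] by blast
qed (use assms in auto)

lemma model_in_disj:
  assumes "model_in H W B" "u \<in> pverts H" "v \<in> pverts H" "p \<in> B u" "p \<in> B v"
  shows "u = v"
  using model_inD(3)[OF assms(1-3)] assms(4,5) by blast

lemma model_in_mono:
  assumes "model_in H W B" "W \<subseteq> W'"
  shows "model_in H W' B"
proof (rule model_inI)
  fix v assume "v \<in> pverts H"
  then show "B v \<subseteq> W'" using model_inD(1)[OF assms(1)] assms(2) by (meson order_trans)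
qed (use model_inD(2,4)[OF assms(1)] model_in_disj[OF assms(1)] in auto)

lemma model_in_insert:
  assumes B: "model_in H W B" and y: "y \<in> W" "\<And>v. v \<in> pverts H \<Longrightarrow> y \<notin> B v"
    and w: "w \<in> pverts H" "x \<in> B w" "E x y"
  shows "model_in H W (B(w := insert y (B w)))"
proof (rule model_inI)
  fix u v p assume "u \<in> pverts H" "v \<in> pverts H" "p \<in> (B(w := insert y (B w))) u" "p \<in> (B(w := insert y (B w))) v"
  then show "u = v" using model_in_disj[OF B, of u v p] y(2) by (auto split: if_splits)
next
  fix u v assume "(u, v) \<in> parcs H"
  then show "\<exists>x \<in> (B(w := insert y (B w))) u. \<exists>y \<in> (B(w := insert y (B w))) v. E x y"
    using model_inD(4)[OF B] by fastforce
next
  fix v assume v: "v \<in> pverts H"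
  show "(B(w := insert y (B w))) v \<subseteq> W" using model_inD(1)[OF B v] y(1) by auto
  show "conn ((B(w := insert y (B w))) v)"
    using model_inD(2)[OF B v] conn_insert[of "B v" x y] w by auto
qed

text \<open>As \<open>W\<close> is connected, uncovered vertices can be absorbed one at a time.
  Covering makes the complement of a subtree a union of branch sets, which is how it is seen to be
  connected.\<close>

lemma model_in_cover:
  assumes "conn W" "finite W" "model_in H W B" "pverts H \<noteq> {}"
  obtains B' where "model_in H W B'" "(\<Union>v \<in> pverts H. B' v) = W"
proof -
  have "\<exists>B'. model_in H W B' \<and> (\<Union>v \<in> pverts H. B' v) = W"
    using assms(3)
  proof (induction "card (W - (\<Union>v \<in> pverts H. B v))" arbitrary: B rule: less_induct)
    case less
    let ?U = "\<Union>v \<in> pverts H. B v"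
    have U: "?U \<subseteq> W" using model_inD(1)[OF less.prems] by blast
    show ?case
    proof (cases "?U = W")
      case True
      then show ?thesis using less.prems by blast
    next
      case False
      obtain h where "h \<in> pverts H" using assms(4) by blast
      then have "?U \<noteq> {}" using connected_on_nonempty[OF model_inD(2)[OF less.prems]] by blast
      then obtain x y where xy: "x \<in> ?U" "y \<in> W" "y \<notin> ?U" "E x y"
        using connected_on_exit[OF assms(1) U _ False] by metis
      then obtain w where w: "w \<in> pverts H" "x \<in> B w" by blast
      let ?B = "B(w := insert y (B w))"
      have m: "model_in H W ?B" using model_in_insert[OF less.prems xy(2) _ w xy(4)] xy(3) by blast
      have "(\<Union>v \<in> pverts H. ?B v) = insert y ?U" using w(1) by (auto split: if_splits)
      then have "W - (\<Union>v \<in> pverts H. ?B v) \<subset> W - ?U" using xy by auto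
      then have "card (W - (\<Union>v \<in> pverts H. ?B v)) < card (W - ?U)"
        using assms(2) by (intro psubset_card_mono) auto
      then show ?thesis using less.hyps m by blast
    qed
  qed
  then show ?thesis using that by blast
qed

text \<open>A closed \<open>X\<close> contains every branch set that it meets, and the indices of
  the contained ones form a closed subset of \<open>I\<close>.\<close>

lemma conn_Union_model:
  assumes B: "model_in H W B" and I: "I \<subseteq> pverts H" "connected_on (\<lambda>u v. (u, v) \<in> parcs H) I"
  shows "conn (\<Union>v \<in> I. B v)"
proof (rule connected_onI)
  have ne: "B v \<noteq> {}" if "v \<in> I" for v using connected_on_nonempty[OF model_inD(2)[OF B]] that I by blast
  then show "(\<Union>v \<in> I. B v) \<noteq> {}" using connected_on_nonempty[OF I(2)] by blast
  fix X assume X: "X \<subseteq> (\<Union>v \<in> I. B v)" "X \<noteq> {}" "\<And>x y. x \<in> X \<Longrightarrow> y \<in> (\<Union>v \<in> I. B v) \<Longrightarrow> E x y \<Longrightarrow> y \<in> X"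
  have all: "B v \<subseteq> X" if "v \<in> I" "x \<in> B v" "x \<in> X" for v x
  proof -
    have "X \<inter> B v = B v"
    proof (rule connected_onD[of E])
      fix x y assume "x \<in> X \<inter> B v" "y \<in> B v" "E x y"
      then show "y \<in> X \<inter> B v" using X(3)[of x y] that(1) by blast
    qed (use that model_inD(2)[OF B] I in auto)
    then show ?thesis by blast
  qed
  have "{v \<in> I. B v \<subseteq> X} = I"
  proof (rule connected_onD[OF I(2)])
    obtain x v where "x \<in> X" "v \<in> I" "x \<in> B v" using X(1,2) by blast
    then show "{v \<in> I. B v \<subseteq> X} \<noteq> {}" using all by blast
  next
    fix u v assume uv: "u \<in> {v \<in> I. B v \<subseteq> X}" "v \<in> I" "(u, v) \<in> parcs H"
    then obtain x y where "x \<in> B u" "y \<in> B v" "E x y" using model_inD(4)[OF B] by blast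
    moreover from this have "y \<in> X" using X(3)[of x y] uv by blast
    ultimately show "v \<in> {v \<in> I. B v \<subseteq> X}" using all[of v y] uv by blast
  qed blast
  then show "X = (\<Union>v \<in> I. B v)" using X(1) by blast
qed

end

section \<open>Binary trees\<close>

text \<open>Parents stay in \<open>I\<close> until \<open>r\<close> is reached, so every nonempty
  closed set climbs to \<open>r\<close>.\<close>

lemma connected_on_tree:
  assumes "r \<in> I" "I \<subseteq> pverts (bin_tree k)" "\<And>y. y \<in> I \<Longrightarrow> y \<noteq> r \<Longrightarrow> \<exists>b ys. y = b # ys \<and> ys \<in> I"
  shows "connected_on (\<lambda>u v. (u, v) \<in> parcs (bin_tree k)) I"
proof -
  interpret symmetric_relation "\<lambda>u v. (u, v) \<in> parcs (bin_tree k)"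
    by unfold_locales (auto simp: bin_tree_def)
  show ?thesis
  proof (rule conn_if_meets[of "{r}"])
    fix X assume X: "X \<subseteq> I" "X \<noteq> {}" "\<And>x y. x \<in> X \<Longrightarrow> y \<in> I \<Longrightarrow> (x, y) \<in> parcs (bin_tree k) \<Longrightarrow> y \<in> X"
    have "r \<in> X" if "x \<in> X" for x
      using that
    proof (induction x)
      case Nil
      show ?case
      proof (rule ccontr)
        assume "r \<notin> X"
        then show False using assms(3)[of "[]"] Nil X(1) by blast
      qed
    next
      case (Cons b x)
      show ?case
      proof (cases "b # x = r")
        case False
        then have "x \<in> I" using assms(3)[of "b # x"] Cons.prems X(1) by blast
        moreover have "(b # x, x) \<in> parcs (bin_tree k)"
          using Cons.prems X(1) assms(2) by (auto simp: bin_tree_def)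
        ultimately show ?thesis using X(3) Cons by blast
      qed (use Cons in blast)
    qed
    then show "X \<inter> {r} \<noteq> {}" using X(2) by blast
  qed (use assms in auto)
qed

text \<open>Lists carry the most recent choice first, so the descendants of \<open>z\<close> are
  those with suffix \<open>z\<close>.\<close>

definition below :: "nat \<Rightarrow> bool list \<Rightarrow> bool list set" where
  "below k z = {ys @ z | ys. length ys + length z \<le> k}"

lemma below_subset: "below k z \<subseteq> pverts (bin_tree k)"
  by (auto simp: below_def bin_tree_def)

lemma self_below: "length z \<le> k \<Longrightarrow> z \<in> below k z"
  by (force simp: below_def)

lemma Cons_below: "b # ys \<in> below k z \<Longrightarrow> b # ys \<noteq> z \<Longrightarrow> ys \<in> below k z"
  by (force simp: below_def append_eq_Cons_conv Cons_eq_append_conv)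

lemma below_Cons: "ys \<in> below k z \<Longrightarrow> length ys < k \<Longrightarrow> b # ys \<in> below k z"
proof -
  assume "ys \<in> below k z" "length ys < k"
  then obtain xs where "ys = xs @ z" by (auto simp: below_def)
  then show ?thesis using \<open>length ys < k\<close> unfolding below_def by (auto intro!: exI[of _ "b # xs"])
qed

lemma below_append: "below k (ys @ z) \<subseteq> below k z"
  by (auto simp: below_def)

lemma below_disjoint: "length y = length z \<Longrightarrow> y \<noteq> z \<Longrightarrow> below k y \<inter> below k z = {}"
  by (auto simp: below_def)

lemma connected_on_below:
  assumes "length z \<le> k"
  shows "connected_on (\<lambda>u v. (u, v) \<in> parcs (bin_tree k)) (below k z)"
proof (rule connected_on_tree)
  fix y assume "y \<in> below k z" "y \<noteq> z"
  then show "\<exists>b ys. y = b # ys \<and> ys \<in> below k z"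
    using Cons_below by (cases y) (auto simp: below_def)
qed (use assms self_below below_subset in auto)

text \<open>Removing a full subtree never removes the parent of a vertex that stays, because lying
  in the subtree passes on to children; \<open>ys\<close> being nonempty keeps the root
  \<open>z\<close>.\<close>

lemma connected_on_below_Diff:
  assumes "length ys + length z \<le> k" "ys \<noteq> []"
  shows "connected_on (\<lambda>u v. (u, v) \<in> parcs (bin_tree k)) (below k z - below k (ys @ z))"
proof (rule connected_on_tree)
  show "z \<in> below k z - below k (ys @ z)" using assms self_below[of z k] by (auto simp: below_def)
  fix y assume y: "y \<in> below k z - below k (ys @ z)" "y \<noteq> z"
  then obtain b xs where b: "y = b # xs" by (cases y) (auto simp: below_def)
  then have "xs \<in> below k z" using Cons_below[of b xs k z] y by blast
  moreover have "xs \<notin> below k (ys @ z)"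
    using below_Cons[of xs k "ys @ z" b] y b below_subset[of k z] by (auto simp: bin_tree_def)
  ultimately show "\<exists>b xs. y = b # xs \<and> xs \<in> below k z - below k (ys @ z)" using b by blast
qed (use below_subset in auto)

lemma below_Nil: "below k [] = pverts (bin_tree k)"
  by (auto simp: below_def bin_tree_def)

context symmetric_relation
begin

section \<open>Tree minors and 2-connected subsets\<close>

definition has_minor_in :: "'b pair_pre_digraph \<Rightarrow> 'a set \<Rightarrow> bool" where
  "has_minor_in H W \<longleftrightarrow> (\<exists>B. model_in H W B)"

lemma has_minor_in_mono: "has_minor_in H W \<Longrightarrow> W \<subseteq> W' \<Longrightarrow> has_minor_in H W'"
  unfolding has_minor_in_def using model_in_mono by blast

lemma model_in_subtree:
  assumes B: "model_in (bin_tree k) W B" and x: "k' + length x \<le> k"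
  shows "model_in (bin_tree k') (\<Union>y \<in> below k x. B y) (\<lambda>y. B (y @ x))"
proof (rule model_inI)
  fix u assume "u \<in> pverts (bin_tree k')"
  then have u: "u @ x \<in> below k x" using x by (auto simp: below_def bin_tree_def)
  then show "B (u @ x) \<subseteq> (\<Union>y \<in> below k x. B y)" by blast
  show "conn (B (u @ x))" using model_inD(2)[OF B] u below_subset by blast
  fix v p assume "v \<in> pverts (bin_tree k')" "p \<in> B (u @ x)" "p \<in> B (v @ x)"
  moreover from this have "v @ x \<in> below k x" using x by (auto simp: below_def bin_tree_def)
  ultimately have "u @ x = v @ x" using model_in_disj[OF B] u below_subset by blast
  then show "u = v" by simp
next
  fix u v assume "(u, v) \<in> parcs (bin_tree k')"
  then have "(u @ x, v @ x) \<in> parcs (bin_tree k)" using x by (auto simp: bin_tree_def)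
  then show "\<exists>p \<in> B (u @ x). \<exists>q \<in> B (v @ x). E p q" using model_inD(4)[OF B] by blast
qed

lemma has_bin_tree_le:
  assumes "has_minor_in (bin_tree k) W" "k' \<le> k"
  shows "has_minor_in (bin_tree k') W"
proof -
  obtain B where B: "model_in (bin_tree k) W B" using assms(1) unfolding has_minor_in_def by blast
  have "model_in (bin_tree k') (\<Union>y \<in> below k []. B y) (\<lambda>y. B (y @ []))"
    using assms(2) by (intro model_in_subtree[OF B]) simp
  then show ?thesis
    unfolding has_minor_in_def using model_in_mono model_inD(1)[OF B] by (metis UN_least below_Nil)
qed

text \<open>A leaf is given the whole subtree of the large tree below it, so an edge to
  \<open>C\<close> from anywhere in that subtree suffices.\<close>

lemma model_in_bin_tree_plus:
  assumes B: "model_in (bin_tree k) W B" and z: "l + length z \<le> k"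
    and C: "conn C" "C \<subseteq> W" "C \<inter> (\<Union>y \<in> below k z. B y) = {}"
    and exit: "\<And>ys. length ys = l \<Longrightarrow> \<exists>p \<in> (\<Union>y \<in> below k (ys @ z). B y). \<exists>q \<in> C. E p q"
  shows "has_minor_in (bin_tree_plus l) W"
proof -
  let ?S = "\<lambda>x. \<Union>y \<in> below k x. B y"
  let ?M = "\<lambda>ys. if length ys < l then B (ys @ z) else ?S (ys @ z)"
  let ?B = "case_option C ?M"
  have sub: "?M ys \<subseteq> ?S z" if "length ys \<le> l" for ys
  proof -
    have "ys @ z \<in> below k z" using that z by (auto simp: below_def)
    then show ?thesis using below_append[of k ys z] by auto
  qed
  have selfM: "B (ys @ z) \<subseteq> ?M ys" if "length ys \<le> l" for ys
    using self_below[of "ys @ z" k] that z by auto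
  have connM: "conn (?M ys)" if "length ys \<le> l" for ys
  proof -
    have "conn (?S (ys @ z))"
      using that z by (intro conn_Union_model[OF B below_subset] connected_on_below) simp
    moreover have "conn (B (ys @ z))" using model_inD(2)[OF B] that z by (simp add: bin_tree_def)
    ultimately show ?thesis by simp
  qed
  \<comment> \<open>A point determines its index in the large tree, and \<open>w\<close> can be
    nonempty only below a leaf; comparing lengths then recovers the vertex of the small
    tree.\<close>
  have index: "\<exists>w. p \<in> B (w @ ys @ z) \<and> length w + length ys + length z \<le> k \<and> (length ys < l \<longrightarrow> w = [])"
    if "length ys \<le> l" "p \<in> ?M ys" for ys p
    using that z by (cases "length ys < l") (auto simp: below_def)
  have disj: "ys = xs" if h: "length ys \<le> l" "length xs \<le> l" "p \<in> ?M ys" "p \<in> ?M xs" for ys xs p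
  proof -
    obtain w where w: "p \<in> B (w @ ys @ z)" "length w + length ys + length z \<le> k" "length ys < l \<longrightarrow> w = []"
      using index[OF h(1,3)] by blast
    obtain w' where w': "p \<in> B (w' @ xs @ z)" "length w' + length xs + length z \<le> k" "length xs < l \<longrightarrow> w' = []"
      using index[OF h(2,4)] by blast
    have "w @ ys @ z = w' @ xs @ z"
      using model_in_disj[OF B _ _ w(1) w'(1)] w(2) w'(2) by (simp add: bin_tree_def)
    then have eq: "w @ ys = w' @ xs" by simp
    show ?thesis
    proof (cases "length ys = length xs")
      case True
      then show ?thesis using eq by simp
    next
      case False
      then consider "length ys < length xs" | "length xs < length ys" by linarith
      then show ?thesis
      proof cases
        case 1
        then show ?thesis using eq w(3) h(2) by (metis append_Nil length_append not_add_less2 order_less_le_trans)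
      next
        case 2
        then show ?thesis using eq w'(3) h(1) by (metis append_Nil length_append not_add_less2 order_less_le_trans)
      qed
    qed
  qed
  have SW: "?S z \<subseteq> W" using model_inD(1)[OF B] below_subset by blast
  have "model_in (bin_tree_plus l) W ?B"
  proof (rule model_inI)
    fix v assume v: "v \<in> pverts (bin_tree_plus l)"
    show "?B v \<subseteq> W"
    proof (cases v)
      case (Some ys)
      then have "length ys \<le> l" using v by (auto simp: bin_tree_plus_def bin_tree_def)
      then show ?thesis using subset_trans[OF sub SW] Some by simp
    qed (use C in simp)
    show "conn (?B v)"
    proof (cases v)
      case (Some ys)
      then have "length ys \<le> l" using v by (auto simp: bin_tree_plus_def bin_tree_def)
      then show ?thesis using connM[of ys] Some by simp
    qed (use C in simp)
  next
    fix u v p assume uv: "u \<in> pverts (bin_tree_plus l)" "v \<in> pverts (bin_tree_plus l)" and p: "p \<in> ?B u" "p \<in> ?B v"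
    have len: "length ys \<le> l" if "Some ys \<in> pverts (bin_tree_plus l)" for ys
      using that by (auto simp: bin_tree_plus_def bin_tree_def)
    have nC: "p \<notin> C" if "length ys \<le> l" "p \<in> ?M ys" for ys using sub[OF that(1)] that(2) C(3) by blast
    show "u = v"
    proof (cases u; cases v)
      fix ys xs assume s: "u = Some ys" "v = Some xs"
      then have "ys = xs" using disj[of ys xs p] len uv p by auto
      then show ?thesis using s by simp
    next
      fix ys assume "u = Some ys" "v = None"
      then show ?thesis using nC[of ys] len uv p by simp
    next
      fix ys assume "v = Some ys" "u = None"
      then show ?thesis using nC[of ys] len uv p by simp
    qed simp
  next
    fix u v assume uv: "(u, v) \<in> parcs (bin_tree_plus l)"
    have tree: "\<exists>p \<in> ?M ys. \<exists>q \<in> ?M xs. E p q" if "(ys, xs) \<in> parcs (bin_tree l)" for ys xs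
    proof -
      have "(ys @ z, xs @ z) \<in> parcs (bin_tree k)" using that z by (auto simp: bin_tree_def)
      then obtain p q where "p \<in> B (ys @ z)" "q \<in> B (xs @ z)" "E p q" using model_inD(4)[OF B] by blast
      moreover have "length ys \<le> l" "length xs \<le> l" using that by (auto simp: bin_tree_def)
      ultimately show ?thesis using selfM by blast
    qed
    have leaf: "\<exists>p \<in> ?M ys. \<exists>q \<in> C. E p q" if "length ys = l" for ys using exit[OF that] that by simp
    from uv consider ys xs where "u = Some ys" "v = Some xs" "(ys, xs) \<in> parcs (bin_tree l)"
      | xs where "u = None" "v = Some xs" "length xs = l" | xs where "u = Some xs" "v = None" "length xs = l"
      by (auto simp: bin_tree_plus_def)
    then show "\<exists>x \<in> ?B u. \<exists>y \<in> ?B v. E x y"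
    proof cases
      case 1
      then show ?thesis using tree[OF 1(3)] by simp
    next
      case 2
      obtain p q where "p \<in> ?M xs" "q \<in> C" "E p q" using leaf[OF 2(3)] by blast
      then have "q \<in> ?B u" "p \<in> ?B v" "E q p" using 2 E_sym by auto
      then show ?thesis by blast
    next
      case 3
      then show ?thesis using leaf[OF 3(3)] by simp
    qed
  qed
  then show ?thesis unfolding has_minor_in_def by blast
qed

text \<open>The levels of \<open>k\<close> are spent as follows: \<open>length z\<close> down to the
  root of \<open>A\<close>, \<open>l\<close> more to the candidates for \<open>D\<close>, and
  \<open>k'\<close> remain inside \<open>D\<close>. Since \<open>z\<close> is not the root, the
  complement of \<open>A\<close> is nonempty.\<close>

lemma biconnected_in_subtree:
  assumes V: "biconn V" "finite V" and B: "model_in (bin_tree k) V B" "(\<Union>y \<in> pverts (bin_tree k). B y) = V"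
    and k: "k = k' + l + length z" "k' \<ge> 1" "l \<ge> 1" "z \<noteq> []"
    and no_plus: "\<not> has_minor_in (bin_tree_plus l) V"
  obtains U where "U \<subseteq> (\<Union>y \<in> below k z. B y)" "biconn U" "conn (V - U)" "has_minor_in (bin_tree k') U"
proof -
  let ?S = "\<lambda>x. \<Union>y \<in> below k x. B y"
  have Diff: "(\<Union>y \<in> I - J. B y) = (\<Union>y \<in> I. B y) - (\<Union>y \<in> J. B y)"
    if "I \<subseteq> pverts (bin_tree k)" "J \<subseteq> pverts (bin_tree k)" for I J
  proof -
    have "x \<notin> (\<Union>y \<in> J. B y)" if "y \<in> I - J" "x \<in> B y" for x y
    proof
      assume "x \<in> (\<Union>y \<in> J. B y)"
      then obtain y' where "y' \<in> J" "x \<in> B y'" by blast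
      moreover from this have "y = y'" using model_in_disj[OF B(1)] that \<open>I \<subseteq> _\<close> \<open>J \<subseteq> _\<close> by blast
      ultimately show False using that by blast
    qed
    then show ?thesis by blast
  qed
  have VS: "V - ?S z = (\<Union>y \<in> below k [] - below k ([] @ z). B y)"
    using Diff[OF below_subset below_subset, of "[]" z] B(2) below_Nil by simp
  have connVS: "conn (V - ?S z)"
    unfolding VS using connected_on_below_Diff[of z "[]" k] k below_subset
    by (intro conn_Union_model[OF B(1)]) auto
  have SV: "?S x \<subseteq> V" for x using B(2) below_subset by blast
  have connS: "conn (?S x)" if "length x \<le> k" for x
    using that by (intro conn_Union_model[OF B(1) below_subset] connected_on_below)
  have "\<exists>ys. length ys = l \<and> \<not> (\<exists>p \<in> ?S (ys @ z). \<exists>q \<in> V - ?S z. E p q)"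
  proof (rule ccontr)
    assume no: "\<not> ?thesis"
    have "has_minor_in (bin_tree_plus l) V"
    proof (rule model_in_bin_tree_plus[OF B(1) _ connVS])
      fix ys :: "bool list" assume "length ys = l"
      then show "\<exists>p \<in> ?S (ys @ z). \<exists>q \<in> V - ?S z. E p q" using no by blast
    qed (use k in auto)
    then show False using no_plus by blast
  qed
  then obtain ys where ys: "length ys = l" "\<And>p q. p \<in> ?S (ys @ z) \<Longrightarrow> q \<in> V - ?S z \<Longrightarrow> \<not> E p q" by blast
  let ?A = "?S z" and ?D = "?S (ys @ z)"
  have DA: "?D \<subseteq> ?A" using below_append by blast
  have "ys \<noteq> []" "length ys + length z \<le> k" using ys(1) k by auto
  then have "conn (\<Union>y \<in> below k z - below k (ys @ z). B y)"
    using below_subset by (intro conn_Union_model[OF B(1)] connected_on_below_Diff) auto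
  then have "conn (?A - ?D)" using Diff[OF below_subset below_subset, of z "ys @ z"] by simp
  then have cut: "conn (?A - {d})" if "d \<in> ?D" for d
    using conn_Diff_if_no_exit[OF V(1) SV _ DA _ that ys(2)] connected_on_nonempty[OF connVS] by blast
  have D: "conn ?D" using ys k by (intro connS) simp
  \<comment> \<open>As \<open>k'\<close> is at least 1, \<open>D\<close> contains two branch sets
    and hence the two vertices demanded by \<open>biconnected_core\<close>.\<close>
  have "ys @ z \<in> below k (ys @ z)" "(True # ys) @ z \<in> below k (ys @ z)"
    using ys k by (auto simp: below_def intro: exI[of _ "[]"] exI[of _ "[True]"])
  moreover from this obtain d1 d2 where d: "d1 \<in> B (ys @ z)" "d2 \<in> B ((True # ys) @ z)"
    using connected_on_nonempty[OF model_inD(2)[OF B(1)]] below_subset by (metis ex_in_conv subsetD)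
  moreover have "d1 \<noteq> d2"
    using model_in_disj[OF B(1), of "ys @ z" "(True # ys) @ z" d1] calculation below_subset[of k "ys @ z"] by auto
  ultimately have dd: "d1 \<in> ?D" "d2 \<in> ?D" "d1 \<noteq> d2" by blast+
  have "conn ?A" using k(1) by (intro connS) simp
  moreover have "finite ?A" using V(2) SV by (rule rev_finite_subset)
  ultimately obtain U where U: "U \<subseteq> ?A" "?D \<subseteq> U" "biconn U" "conn (V - U)"
    using biconnected_core[OF V(1) _ _ SV connVS D DA dd cut] by metis
  have "has_minor_in (bin_tree k') ?D"
    unfolding has_minor_in_def using model_in_subtree[OF B(1), of k' "ys @ z"] ys k by auto
  then show ?thesis by (intro that[OF U(1,3,4)] has_minor_in_mono[OF _ U(2)])
qed

text \<open>There are four disjoint subtrees at depth 2, of which \<open>a\<close> and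
  \<open>b\<close> meet at most one each; two others provide \<open>W1\<close> and
  \<open>W2\<close>. This is the origin of the summand 2.\<close>

lemma two_biconnected_subsets:
  assumes V: "biconn V" "finite V" and k: "k' \<ge> 1" "l \<ge> 1" "has_minor_in (bin_tree (k' + l + 2)) V"
    and no_plus: "\<not> has_minor_in (bin_tree_plus l) V"
  obtains W1 W2 where "W1 \<subseteq> V" "W2 \<subseteq> V" "W1 \<inter> W2 = {}" "biconn W1" "biconn W2" "conn (V - W1)" "conn (V - W2)"
    "has_minor_in (bin_tree k') W1" "has_minor_in (bin_tree k') W2" "a \<notin> W1 \<union> W2" "b \<notin> W1 \<union> W2"
proof -
  let ?k = "k' + l + 2"
  obtain B0 where "model_in (bin_tree ?k) V B0" using k(3) unfolding has_minor_in_def by blast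
  then obtain B where B: "model_in (bin_tree ?k) V B" "(\<Union>y \<in> pverts (bin_tree ?k). B y) = V"
    using model_in_cover[OF biconnected_on_connected[OF V(1)] V(2)] by (metis below_Nil self_below empty_iff list.size(3) zero_le)
  let ?S = "\<lambda>x. \<Union>y \<in> below ?k x. B y"
  have disj: "?S y \<inter> ?S z = {}" if "length y = length z" "y \<noteq> z" for y z
  proof (rule ccontr)
    assume "?S y \<inter> ?S z \<noteq> {}"
    then obtain p s t where st: "p \<in> B s" "p \<in> B t" "s \<in> below ?k y" "t \<in> below ?k z" by blast
    then have "s = t" using model_in_disj[OF B(1)] below_subset by blast
    then show False using below_disjoint[OF that] st by blast
  qed
  have "\<exists>z z'. length z = 2 \<and> length z' = 2 \<and> z \<noteq> z' \<and> a \<notin> ?S z \<union> ?S z' \<and> b \<notin> ?S z \<union> ?S z'"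
  proof -
    have four: "\<exists>z. length z = 2 \<and> (\<forall>w. length w = 2 \<longrightarrow> w \<noteq> z \<longrightarrow> c \<notin> ?S w)" for c
    proof (cases "\<exists>z. length z = 2 \<and> c \<in> ?S z")
      case True
      then obtain z where "length z = 2" "c \<in> ?S z" by blast
      then show ?thesis using disj[of _ z] by (metis IntI empty_iff)
    next
      case False
      then show ?thesis by (intro exI[of _ "[True, True]"]) auto
    qed
    obtain za where za: "length za = 2" "\<And>w. length w = 2 \<Longrightarrow> w \<noteq> za \<Longrightarrow> a \<notin> ?S w" using four[of a] by blast
    obtain zb where zb: "length zb = 2" "\<And>w. length w = 2 \<Longrightarrow> w \<noteq> zb \<Longrightarrow> b \<notin> ?S w" using four[of b] by blast
    have "card {w :: bool list. length w = 2} = 4"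
      using card_lists_length_eq[of "UNIV :: bool set" 2] by simp
    then have "card ({w. length w = 2} - {za, zb}) \<ge> 4 - card {za, zb}"
      using diff_card_le_card_Diff[of "{za, zb}" "{w. length w = 2}"] by simp
    moreover have "card {za, zb} \<le> 2" by (cases "za = zb") auto
    ultimately have "2 \<le> card ({w. length w = 2} - {za, zb})" by linarith
    then have "\<not> card ({w. length w = 2} - {za, zb}) \<le> Suc 0" and "finite ({w. length w = 2} - {za, zb})"
      by (simp, metis card.infinite not_numeral_le_zero)
    then obtain z z' where "z \<noteq> z'" "z \<in> {w. length w = 2} - {za, zb}" "z' \<in> {w. length w = 2} - {za, zb}"
      by (subst (asm) card_le_Suc0_iff_eq) blast+
    then show ?thesis using za(2) zb(2) by (intro exI[of _ z] exI[of _ z']) auto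
  qed
  then obtain z z' where z: "length z = 2" "length z' = 2" "z \<noteq> z'" "a \<notin> ?S z \<union> ?S z'" "b \<notin> ?S z \<union> ?S z'"
    by blast
  have ex: "\<exists>U \<subseteq> ?S w. biconn U \<and> conn (V - U) \<and> has_minor_in (bin_tree k') U" if "length w = 2" for w
    using biconnected_in_subtree[OF V B _ k(1,2) _ no_plus, of w] that by force
  obtain W1 where W1: "W1 \<subseteq> ?S z" "biconn W1" "conn (V - W1)" "has_minor_in (bin_tree k') W1" using ex[OF z(1)] by blast
  obtain W2 where W2: "W2 \<subseteq> ?S z'" "biconn W2" "conn (V - W2)" "has_minor_in (bin_tree k') W2" using ex[OF z(2)] by blast
  have SV: "?S w \<subseteq> V" for w using B(2) below_subset by blast
  have d: "?S z \<inter> ?S z' = {}" using z(1-3) by (intro disj) simp_all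
  have "W1 \<inter> W2 \<subseteq> {}" using Int_mono[OF W1(1) W2(1)] unfolding d .
  moreover have "a \<notin> W1 \<union> W2" using Un_mono[OF W1(1) W2(1)] z(4) by (rule contra_subsetD)
  moreover have "b \<notin> W1 \<union> W2" using Un_mono[OF W1(1) W2(1)] z(5) by (rule contra_subsetD)
  moreover have "W1 \<subseteq> V" "W2 \<subseteq> V" using subset_trans[OF W1(1) SV] subset_trans[OF W2(1) SV] by auto
  ultimately show ?thesis using W1(2-4) W2(2-4) by (intro that) auto
qed

section \<open>Rooted models\<close>

definition rooted_nabla :: "nat \<Rightarrow> 'a set \<Rightarrow> 'a \<Rightarrow> 'a \<Rightarrow> bool" where
  "rooted_nabla i W a b \<longleftrightarrow> (\<exists>B. model_in (nabla i) W B \<and> a \<in> B 0 \<and> b \<in> B (2 ^ i))"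

definition rooted_plus :: "nat \<Rightarrow> 'a set \<Rightarrow> 'a \<Rightarrow> 'a \<Rightarrow> bool" where
  "rooted_plus j W a b \<longleftrightarrow> (\<exists>B. model_in (bin_tree_plus j) W B \<and> a \<in> B (Some []) \<and> b \<in> B None)"

text \<open>
  The stem \<open>S\<close> keeps \<open>a\<close> apart from the branch set of the tree root, so that two planted models can be
  hung below a common new root.
\<close>

definition planted_plus :: "nat \<Rightarrow> 'a set \<Rightarrow> 'a \<Rightarrow> 'a \<Rightarrow> bool" where
  "planted_plus j W a b \<longleftrightarrow> (\<exists>B S. model_in (bin_tree_plus j) W B \<and> b \<in> B None \<and>
     conn S \<and> S \<subseteq> W \<and> a \<in> S \<and> (\<forall>v \<in> pverts (bin_tree_plus j). S \<inter> B v = {}) \<and>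
     (\<exists>p \<in> S. \<exists>q \<in> B (Some []). E p q))"

text \<open>Each tail meets \<open>W'\<close> in a single vertex that already belongs to the branch
  set it is added to, so no overlaps arise.\<close>

lemma model_in_extend:
  assumes B: "model_in H W' B" and r: "r \<in> pverts H" "s \<in> pverts H" "r \<noteq> s" "x \<in> B r" "y \<in> B s"
    and X: "conn X" "X \<subseteq> W" "X \<inter> W' = {x}" and Y: "conn Y" "Y \<subseteq> W" "Y \<inter> W' = {y}"
    and XY: "X \<inter> Y = {}" and W: "W' \<subseteq> W"
  shows "model_in H W (B(r := B r \<union> X, s := B s \<union> Y))"
proof (rule model_inI)
  let ?B = "B(r := B r \<union> X, s := B s \<union> Y)"
  fix v assume v: "v \<in> pverts H"
  have BW: "B w \<subseteq> W" if "w \<in> pverts H" for w using subset_trans[OF model_inD(1)[OF B that] W] .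
  show "?B v \<subseteq> W" using BW[OF v] BW[OF r(1)] BW[OF r(2)] X(2) Y(2) by simp
  have "x \<in> X" "y \<in> Y" using X(3) Y(3) by auto
  then have "conn (B r \<union> X)" "conn (B s \<union> Y)"
    using conn_Un[OF model_inD(2)[OF B r(1)] X(1)] conn_Un[OF model_inD(2)[OF B r(2)] Y(1)] r(4,5) by auto
  then show "conn (?B v)" using model_inD(2)[OF B v] by simp
  fix u p assume u: "u \<in> pverts H" and p: "p \<in> ?B u" "p \<in> ?B v"
  have key: "p \<in> X \<Longrightarrow> p \<in> B w \<Longrightarrow> w = r" "p \<in> Y \<Longrightarrow> p \<in> B w \<Longrightarrow> w = s" if "w \<in> pverts H" for w
  proof -
    have sub: "B w \<subseteq> W'" using model_inD(1)[OF B that] .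
    { assume "p \<in> X" "p \<in> B w"
      then have "p = x" using sub X(3) by blast
      then show "w = r" using model_in_disj[OF B that r(1)] \<open>p \<in> B w\<close> r(4) by blast }
    { assume "p \<in> Y" "p \<in> B w"
      then have "p = y" using sub Y(3) by blast
      then show "w = s" using model_in_disj[OF B that r(2)] \<open>p \<in> B w\<close> r(5) by blast }
  qed
  have cases: "p \<in> B w \<or> p \<in> X \<and> w = r \<or> p \<in> Y \<and> w = s" if "p \<in> ?B w" for w
    using that by (auto split: if_splits)
  have nXY: "\<not> (p \<in> X \<and> p \<in> Y)" using XY by blast
  show "u = v"
    using cases[OF p(1)] cases[OF p(2)] key[OF u] key[OF v] model_in_disj[OF B u v] nXY by metis
next
  fix u v assume "(u, v) \<in> parcs H"
  then obtain p q where "p \<in> B u" "q \<in> B v" "E p q" using model_inD(4)[OF B] by blast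
  then show "\<exists>x \<in> (B(r := B r \<union> X, s := B s \<union> Y)) u. \<exists>y \<in> (B(r := B r \<union> X, s := B s \<union> Y)) v. E x y"
    by (intro bexI[of _ p] bexI[of _ q]) auto
qed

lemma rooted_nabla_extend:
  assumes "rooted_nabla i W' x y" and "conn X" "X \<subseteq> W" "X \<inter> W' = {x}" "conn Y" "Y \<subseteq> W" "Y \<inter> W' = {y}"
    and "X \<inter> Y = {}" "W' \<subseteq> W" "a \<in> X" "b \<in> Y"
  shows "rooted_nabla i W a b"
proof -
  obtain B where B: "model_in (nabla i) W' B" "x \<in> B 0" "y \<in> B (2 ^ i)"
    using assms(1) unfolding rooted_nabla_def by blast
  have "model_in (nabla i) W (B(0 := B 0 \<union> X, 2 ^ i := B (2 ^ i) \<union> Y))"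
    using assms(2-9) B by (intro model_in_extend[OF B(1)]) (simp_all add: pverts_nabla)
  then show ?thesis unfolding rooted_nabla_def using assms(10,11)
    by (intro exI[of _ "B(0 := B 0 \<union> X, 2 ^ i := B (2 ^ i) \<union> Y)"]) auto
qed

lemma rooted_plus_extend:
  assumes "rooted_plus j W' x y" and "conn X" "X \<subseteq> W" "X \<inter> W' = {x}" "conn Y" "Y \<subseteq> W" "Y \<inter> W' = {y}"
    and "X \<inter> Y = {}" "W' \<subseteq> W" "a \<in> X" "b \<in> Y"
  shows "rooted_plus j W a b"
proof -
  obtain B where B: "model_in (bin_tree_plus j) W' B" "x \<in> B (Some [])" "y \<in> B None"
    using assms(1) unfolding rooted_plus_def by blast
  have "model_in (bin_tree_plus j) W (B(Some [] := B (Some []) \<union> X, None := B None \<union> Y))"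
    using assms(2-9) B by (intro model_in_extend[OF B(1)]) (simp_all add: bin_tree_plus_def bin_tree_def)
  then show ?thesis unfolding rooted_plus_def using assms(10,11)
    by (intro exI[of _ "B(Some [] := B (Some []) \<union> X, None := B None \<union> Y)"]) auto
qed

text \<open>The link from \<open>a\<close> is not absorbed into the root branch set; its part before
  \<open>x\<close> is kept as the stem.\<close>

lemma planted_plus_extend:
  assumes "rooted_plus j W' x y" and X: "conn (X - {x})" "p \<in> X - {x}" "E p x" "X \<subseteq> W" "X \<inter> W' = {x}"
    and Y: "conn Y" "Y \<subseteq> W" "Y \<inter> W' = {y}"
    and XY: "X \<inter> Y = {}" "W' \<subseteq> W" "a \<in> X - {x}" "b \<in> Y"
  shows "planted_plus j W a b"
proof -
  obtain B where B: "model_in (bin_tree_plus j) W' B" "x \<in> B (Some [])" "y \<in> B None"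
    using assms(1) unfolding rooted_plus_def by blast
  have mem: "Some [] \<in> pverts (bin_tree_plus j)" "None \<in> pverts (bin_tree_plus j)"
    by (simp_all add: bin_tree_plus_def bin_tree_def)
  have x: "x \<in> X" "x \<in> W'" using X(5) by auto
  \<comment> \<open>\<open>x\<close> is in \<open>B (Some [])\<close> already; the trivial tail
    \<open>{x}\<close> only fits the form of \<open>model_in_extend\<close>.\<close>
  let ?B = "B(Some [] := B (Some []) \<union> {x}, None := B None \<union> Y)"
  have "model_in (bin_tree_plus j) W ?B"
    using mem X(4) Y XY(1,2) B x by (intro model_in_extend[OF B(1)]) auto
  moreover have "(X - {x}) \<inter> ?B v = {}" if "v \<in> pverts (bin_tree_plus j)" for v
  proof -
    have "?B v \<subseteq> W' \<union> Y" using model_inD(1)[OF B(1) that] x by auto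
    moreover have "(X - {x}) \<inter> (W' \<union> Y) = {}" using X(5) XY(1) by blast
    ultimately show ?thesis by blast
  qed
  moreover have "x \<in> ?B (Some [])" "b \<in> ?B None" "X - {x} \<subseteq> W" using XY X(4) by auto
  ultimately show ?thesis unfolding planted_plus_def using X(1-3) XY(3)
    by (intro exI[of _ ?B] exI[of _ "X - {x}"]) blast
qed

lemma biconn_edge_to:
  assumes "biconn W" "a \<in> W" "b \<in> W" "a \<noteq> b"
  obtains p where "p \<in> W - {b}" "E p b"
proof -
  have "W - {b} \<subseteq> W" "W - {b} \<noteq> {}" "W - {b} \<noteq> W" using assms by auto
  then obtain p y where "p \<in> W - {b}" "y \<in> W" "y \<notin> W - {b}" "E p y"
    by (rule connected_on_exit[OF biconnected_on_connected[OF assms(1)]])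
  then show ?thesis using that by auto
qed

text \<open>\<open>nabla 0\<close>, like \<open>bin_tree_plus 0\<close>, is a single edge. Its ends
  become \<open>{b}\<close> and \<open>W - {b}\<close>, which is connected because \<open>b\<close>
  is no cut vertex.\<close>

lemma rooted_nabla_0:
  assumes "biconn W" "a \<in> W" "b \<in> W" "a \<noteq> b"
  shows "rooted_nabla 0 W a b"
proof -
  obtain p where p: "p \<in> W - {b}" "E p b" using biconn_edge_to[OF assms] .
  let ?B = "\<lambda>m :: nat. if m = 0 then W - {b} else {b}"
  have "model_in (nabla 0) W ?B"
  proof (rule model_inI)
    fix u v assume "(u, v) \<in> parcs (nabla 0)"
    then show "\<exists>x \<in> ?B u. \<exists>y \<in> ?B v. E x y" using p E_sym[OF p(2)] by auto
  qed (use biconnected_on_Diff[OF assms(1)] assms in \<open>auto split: if_splits\<close>)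
  then show ?thesis unfolding rooted_nabla_def using assms by (intro exI[of _ ?B]) auto
qed

lemma rooted_plus_0:
  assumes "biconn W" "a \<in> W" "b \<in> W" "a \<noteq> b"
  shows "rooted_plus 0 W a b"
proof -
  obtain p where p: "p \<in> W - {b}" "E p b" using biconn_edge_to[OF assms] .
  let ?B = "\<lambda>m :: bool list option. if m = None then {b} else W - {b}"
  have "model_in (bin_tree_plus 0) W ?B"
  proof (rule model_inI)
    fix u v assume "(u, v) \<in> parcs (bin_tree_plus 0)"
    then show "\<exists>x \<in> ?B u. \<exists>y \<in> ?B v. E x y" using p E_sym[OF p(2)] by (auto simp: bin_tree_plus_def bin_tree_def)
  qed (use biconnected_on_Diff[OF assms(1)] assms in \<open>auto simp: bin_tree_plus_def bin_tree_def split: if_splits\<close>)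
  then show ?thesis unfolding rooted_plus_def using assms by (intro exI[of _ ?B]) auto
qed

text \<open>\<open>Y\<close> glues the last vertex of the first model to the first vertex of the
  second, and the edge from \<open>p\<close> to \<open>q\<close> realises the new root edge.\<close>

lemma rooted_nabla_Suc:
  assumes n1: "rooted_nabla i W1 x y1" and n2: "rooted_nabla i W2 y2 z"
    and W: "W1 \<subseteq> W" "W2 \<subseteq> W" "W1 \<inter> W2 = {}"
    and c: "conn X" "conn Y" "conn Z" and s: "X \<subseteq> W" "Y \<subseteq> W" "Z \<subseteq> W"
    and d: "X \<inter> Y = {}" "X \<inter> Z = {}" "Y \<inter> Z = {}" and ab: "a \<in> X" "b \<in> Z" and e: "p \<in> X" "q \<in> Z" "E p q"
    and X: "X \<inter> W1 = {x}" "X \<inter> W2 = {}" and Y: "Y \<inter> W1 = {y1}" "Y \<inter> W2 = {y2}"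
    and Z: "Z \<inter> W1 = {}" "Z \<inter> W2 = {z}"
  shows "rooted_nabla (Suc i) W a b"
proof -
  obtain B1 where B1: "model_in (nabla i) W1 B1" "x \<in> B1 0" "y1 \<in> B1 (2 ^ i)"
    using n1 unfolding rooted_nabla_def by blast
  obtain B2 where B2: "model_in (nabla i) W2 B2" "y2 \<in> B2 0" "z \<in> B2 (2 ^ i)"
    using n2 unfolding rooted_nabla_def by blast
  define N :: nat where "N = 2 ^ i"
  have N: "N > 0" "2 ^ Suc i = N + N" unfolding N_def by simp_all
  \<comment> \<open>A union of three partial maps, because at \<open>m = N\<close> all of them
    contribute: \<open>B1 N\<close>, \<open>B2 0\<close> and \<open>Y\<close>.\<close>
  let ?L = "\<lambda>m. if m \<le> N then B1 m else {}"
  let ?R = "\<lambda>m. if N \<le> m then B2 (m - N) else {}"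
  let ?P = "\<lambda>m. if m = 0 then X else if m = N then Y else if m = N + N then Z else {}"
  let ?B = "\<lambda>m. ?L m \<union> ?R m \<union> ?P m"
  have v: "m \<in> pverts (nabla i) \<longleftrightarrow> m \<le> N" "m \<in> pverts (nabla (Suc i)) \<longleftrightarrow> m \<le> N + N" for m
    unfolding pverts_nabla N(2) by (simp_all add: N_def)
  have mem: "x \<in> X" "y1 \<in> Y" "y2 \<in> Y" "z \<in> Z" using X Y Z by auto
  have inB: "B1 m \<subseteq> W1" "B2 m \<subseteq> W2" "conn (B1 m)" "conn (B2 m)" if "m \<le> N" for m
    using model_inD(1,2)[OF B1(1)] model_inD(1,2)[OF B2(1)] v(1) that by auto
  have "model_in (nabla (Suc i)) W ?B"
  proof (rule model_inI)
    fix m assume "m \<in> pverts (nabla (Suc i))"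
    then have m: "m \<le> N + N" using v(2) by blast
    have "n \<le> N \<Longrightarrow> B1 n \<subseteq> W" "n \<le> N \<Longrightarrow> B2 n \<subseteq> W" for n
      using subset_trans[OF inB(1) W(1)] subset_trans[OF inB(2) W(2)] by auto
    from this(1)[of m] this(2)[of "m - N"] this(2)[of 0] show "?B m \<subseteq> W" using m s by simp
    show "conn (?B m)"
    proof -
      consider "m = 0" | "0 < m" "m < N" | "m = N" | "N < m" "m < N + N" | "m = N + N" using m by linarith
      then show ?thesis
      proof cases
        case 1
        have "conn (B1 0 \<union> X)" using conn_Un[OF inB(3) c(1)] B1(2) mem by auto
        then show ?thesis using 1 N by simp
      next
        case 2
        then show ?thesis using inB(3)[of m] by simp
      next
        case 3
        have "conn (B1 N \<union> Y)" using conn_Un[OF inB(3) c(2), of N] B1(3) mem unfolding N_def by auto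
        then have "conn (B1 N \<union> Y \<union> B2 0)" using conn_Un[OF _ inB(4)[of 0], of "B1 N \<union> Y"] B2(2) mem by auto
        moreover have "B1 N \<union> Y \<union> B2 0 = B1 N \<union> B2 0 \<union> Y" by blast
        ultimately show ?thesis using 3 N by simp
      next
        case 4
        then show ?thesis using inB(4)[of "m - N"] by simp
      next
        case 5
        have "conn (B2 N \<union> Z)" using conn_Un[OF inB(4) c(3), of N] B2(3) mem unfolding N_def by auto
        then show ?thesis using 5 N by simp
      qed
    qed
    fix m' r assume "m' \<in> pverts (nabla (Suc i))" and r: "r \<in> ?B m" "r \<in> ?B m'"
    then have m': "m' \<le> N + N" using v(2) by blast
    have rX: "r \<in> X \<Longrightarrow> r \<in> W1 \<Longrightarrow> r = x" "r \<in> X \<Longrightarrow> r \<notin> W2" "r \<in> Y \<Longrightarrow> r \<in> W1 \<Longrightarrow> r = y1"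
      "r \<in> Y \<Longrightarrow> r \<in> W2 \<Longrightarrow> r = y2" "r \<in> Z \<Longrightarrow> r \<notin> W1" "r \<in> Z \<Longrightarrow> r \<in> W2 \<Longrightarrow> r = z"
      "r \<in> W1 \<Longrightarrow> r \<notin> W2" "r \<in> X \<Longrightarrow> r \<notin> Y" "r \<in> X \<Longrightarrow> r \<notin> Z" "r \<in> Y \<Longrightarrow> r \<notin> Z"
      using X Y Z W(3) d by auto
    have L: "r \<in> W1 \<and> (r \<in> X \<longrightarrow> n = 0) \<and> (r \<in> Y \<longrightarrow> n = N)" if "n \<le> N" "r \<in> B1 n" for n
      using inB(1)[OF that(1)] that model_in_disj[OF B1(1), of n 0 r] model_in_disj[OF B1(1), of n N r] B1(2,3)
        v(1) rX(1,3) unfolding N_def by auto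
    have R: "r \<in> W2 \<and> (r \<in> Y \<longrightarrow> n = 0) \<and> (r \<in> Z \<longrightarrow> n = N)" if "n \<le> N" "r \<in> B2 n" for n
      using inB(2)[OF that(1)] that model_in_disj[OF B2(1), of n 0 r] model_in_disj[OF B2(1), of n N r] B2(2,3)
        v(1) rX(4,6) unfolding N_def by auto
    have cas: "n \<le> N \<and> r \<in> B1 n \<or> N \<le> n \<and> r \<in> B2 (n - N) \<or> n = 0 \<and> r \<in> X \<or> n = N \<and> r \<in> Y \<or> n = N + N \<and> r \<in> Z"
      if "r \<in> ?B n" for n using that by (auto split: if_splits)
    have LL: "n = n'" if "n \<le> N" "n' \<le> N" "r \<in> B1 n" "r \<in> B1 n'" for n n'
      using model_in_disj[OF B1(1)] v(1) that by blast
    have RR: "n = n'" if "n \<le> N" "n' \<le> N" "r \<in> B2 n" "r \<in> B2 n'" for n n'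
      using model_in_disj[OF B2(1)] v(1) that by blast
    have sub: "m - N \<le> N" "m' - N \<le> N" using m m' by auto
    have c': "(m' \<le> N \<and> r \<in> B1 m') \<or> (N \<le> m' \<and> r \<in> B2 (m' - N)) \<or> (m' = 0 \<and> r \<in> X) \<or> (m' = N \<and> r \<in> Y) \<or>
      (m' = N + N \<and> r \<in> Z)" using cas[OF r(2)] .
    note L' = L[of m'] and R' = R[OF sub(2)]
    from cas[OF r(1)] show "m = m'"
    proof (elim disjE conjE)
      assume 1: "m \<le> N" "r \<in> B1 m"
      from c' show ?thesis using 1 LL[of m m'] L[OF 1] R' rX(5,7) by (elim disjE conjE) auto
    next
      assume 1: "N \<le> m" "r \<in> B2 (m - N)"
      from c' show ?thesis using 1 RR[OF sub] R[OF sub(1) 1(2)] L' rX(2,7) by (elim disjE conjE) auto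
    next
      assume 1: "m = 0" "r \<in> X"
      from c' show ?thesis using 1 L' R' rX(2,8,9) by (elim disjE conjE) auto
    next
      assume 1: "m = N" "r \<in> Y"
      from c' show ?thesis using 1 L' R' rX(8,10) by (elim disjE conjE) auto
    next
      assume 1: "m = N + N" "r \<in> Z"
      from c' show ?thesis using 1 L' R' rX(5,9,10) by (elim disjE conjE) auto
    qed
  next
    fix u v assume uv: "(u, v) \<in> parcs (nabla (Suc i))"
    have bound: "u \<le> N" "v \<le> N" if "(u, v) \<in> parcs (nabla i)" for u v
    proof -
      interpret pair_graph "nabla i" by (rule pair_graph_nabla)
      show "u \<le> N" "v \<le> N" using wellformed[OF that] pverts_nabla[of i] by (auto simp: N_def)
    qed
    have "(u, v) \<in> parcs (nabla i) \<or> (\<exists>u' v'. u = u' + N \<and> v = v' + N \<and> (u', v') \<in> parcs (nabla i)) \<or>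
      (u = 0 \<and> v = N + N) \<or> (u = N + N \<and> v = 0)"
      using uv N(2) unfolding nabla.simps N_def[symmetric] by auto
    then consider "(u, v) \<in> parcs (nabla i)"
      | u' v' where "u = u' + N" "v = v' + N" "(u', v') \<in> parcs (nabla i)"
      | "u = 0" "v = N + N" | "u = N + N" "v = 0" by blast
    then show "\<exists>x \<in> ?B u. \<exists>y \<in> ?B v. E x y"
    proof cases
      case 1
      then obtain p q where "p \<in> B1 u" "q \<in> B1 v" "E p q" using model_inD(4)[OF B1(1)] by blast
      then show ?thesis using bound[OF 1] by (intro bexI[of _ p] bexI[of _ q]) auto
    next
      case 2
      then obtain p q where "p \<in> B2 u'" "q \<in> B2 v'" "E p q" using model_inD(4)[OF B2(1)] by blast
      then show ?thesis using 2 by (intro bexI[of _ p] bexI[of _ q]) auto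
    next
      case 3
      then show ?thesis using e N by (intro bexI[of _ p] bexI[of _ q]) auto
    next
      case 4
      then show ?thesis using e E_sym N by (intro bexI[of _ q] bexI[of _ p]) auto
    qed
  qed
  then show ?thesis unfolding rooted_nabla_def using ab N by (intro exI[of _ ?B]) auto
qed

text \<open>\<open>X\<close> with the two stems becomes the new root, and \<open>Y\<close> merges
  the two apices. The stems keep the old roots outside the new one, so they become its
  children.\<close>

lemma rooted_plus_Suc:
  assumes p1: "planted_plus j W1 x1 y1" and p2: "planted_plus j W2 x2 y2"
    and W: "W1 \<subseteq> W" "W2 \<subseteq> W" "W1 \<inter> W2 = {}"
    and c: "conn X" "conn Y" and s: "X \<subseteq> W" "Y \<subseteq> W" "X \<inter> Y = {}" and ab: "a \<in> X" "b \<in> Y"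
    and X: "X \<inter> W1 = {x1}" "X \<inter> W2 = {x2}" and Y: "Y \<inter> W1 = {y1}" "Y \<inter> W2 = {y2}"
  shows "rooted_plus (Suc j) W a b"
proof -
  let ?H = "bin_tree_plus j"
  obtain B1 S1 where B1: "model_in ?H W1 B1" "y1 \<in> B1 None" "conn S1" "S1 \<subseteq> W1" "x1 \<in> S1"
    "\<And>v. v \<in> pverts ?H \<Longrightarrow> S1 \<inter> B1 v = {}" "\<exists>p \<in> S1. \<exists>q \<in> B1 (Some []). E p q"
    using p1 unfolding planted_plus_def by blast
  obtain B2 S2 where B2: "model_in ?H W2 B2" "y2 \<in> B2 None" "conn S2" "S2 \<subseteq> W2" "x2 \<in> S2"
    "\<And>v. v \<in> pverts ?H \<Longrightarrow> S2 \<inter> B2 v = {}" "\<exists>p \<in> S2. \<exists>q \<in> B2 (Some []). E p q"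
    using p2 unfolding planted_plus_def by blast
  let ?A = "X \<union> S1 \<union> S2" and ?C = "Y \<union> B1 None \<union> B2 None"
  define M where "M c = (if c then B1 else B2)" for c
  \<comment> \<open>The choice made at the root is the last list element, so \<open>last ys\<close>
    selects the copy and \<open>butlast ys\<close> is the vertex inside it.\<close>
  let ?M = "\<lambda>ys. if ys = [] then ?A else M (last ys) (Some (butlast ys))"
  let ?B = "case_option ?C ?M"
  have none: "None \<in> pverts ?H" and some: "Some ys \<in> pverts ?H \<longleftrightarrow> length ys \<le> j" for ys
    by (auto simp: bin_tree_plus_def bin_tree_def)
  have some': "Some ys \<in> pverts (bin_tree_plus (Suc j)) \<longleftrightarrow> length ys \<le> Suc j" for ys
    by (auto simp: bin_tree_plus_def bin_tree_def)
  have mem: "x1 \<in> X" "x2 \<in> X" "y1 \<in> Y" "y2 \<in> Y" using X Y by auto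
  have MI: "M c v \<subseteq> (if c then W1 else W2)" "conn (M c v)" if "v \<in> pverts ?H" for c v
    using model_inD(1,2)[OF B1(1) that] model_inD(1,2)[OF B2(1) that] unfolding M_def by auto
  have Mdisj: "u = v" if "u \<in> pverts ?H" "v \<in> pverts ?H" "p \<in> M c u" "p \<in> M c v" for c u v p
    using model_in_disj[OF B1(1) that(1,2)] model_in_disj[OF B2(1) that(1,2)] that(3,4)
    unfolding M_def by (auto split: if_splits)
  have Medge: "\<exists>p \<in> M c u. \<exists>q \<in> M c v. E p q" if "(u, v) \<in> parcs ?H" for c u v
    using model_inD(4)[OF B1(1) that] model_inD(4)[OF B2(1) that] unfolding M_def by auto
  have XS1: "conn (X \<union> S1)" using conn_Un[OF c(1) B1(3)] mem B1(5) by blast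
  have connA: "conn ?A" using conn_Un[OF XS1 B2(3)] mem B2(5) by blast
  have YB1: "conn (Y \<union> B1 None)" using conn_Un[OF c(2) model_inD(2)[OF B1(1) none]] mem B1(2) by blast
  have connC: "conn ?C" using conn_Un[OF YB1 model_inD(2)[OF B2(1) none]] mem B2(2) by blast
  define Wc where "Wc c = (if c then W1 else W2)" for c
  define Sc where "Sc c = (if c then S1 else S2)" for c
  have MW: "p \<in> Wc c" if "v \<in> pverts ?H" "p \<in> M c v" for c v p
    using MI(1)[OF that(1), of c] that(2) unfolding Wc_def by auto
  have inW: "M c v \<subseteq> W" if "v \<in> pverts ?H" for c v using MI(1)[OF that, of c] W(1,2) by (cases c) auto
  have SM: "p \<notin> M c v" if "v \<in> pverts ?H" "p \<in> Sc c" for c v p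
    using B1(6)[OF that(1)] B2(6)[OF that(1)] that(2) unfolding Sc_def M_def by (cases c) auto
  \<comment> \<open>\<open>X\<close> enters a copy only at a vertex of its stem, so within copy
    \<open>c\<close> the new root is just the stem.\<close>
  have A_in: "p \<in> Sc c" if p: "p \<in> ?A" "p \<in> Wc c" for p c
  proof (cases c)
    case True
    then have "p \<in> W1" "p \<notin> S2" using p(2) B2(4) W(3) unfolding Wc_def by auto
    then have "p = x1 \<or> p \<in> S1" using p(1) X(1) by (metis IntI Un_iff singletonD)
    then have "p \<in> S1" using B1(5) by blast
    then show ?thesis using True by (simp add: Sc_def)
  next
    case False
    then have "p \<in> W2" "p \<notin> S1" using p(2) B1(4) W(3) unfolding Wc_def by auto
    then have "p = x2 \<or> p \<in> S2" using p(1) X(2) by (metis IntI Un_iff singletonD)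
    then have "p \<in> S2" using B2(5) by blast
    then show ?thesis using False by (simp add: Sc_def)
  qed
  have N1: "B1 None \<subseteq> W1" "B2 None \<subseteq> W2" using model_inD(1)[OF B1(1) none] model_inD(1)[OF B2(1) none] by auto
  have C_in: "p \<in> M c None" if p: "p \<in> ?C" "p \<in> Wc c" for p c
  proof (cases c)
    case True
    then have "p \<in> W1" "p \<notin> B2 None" using p(2) N1 W(3) unfolding Wc_def by auto
    then have "p = y1 \<or> p \<in> B1 None" using p(1) Y(1) by (metis IntI Un_iff singletonD)
    then have "p \<in> B1 None" using B1(2) by blast
    then show ?thesis using True by (simp add: M_def)
  next
    case False
    then have "p \<in> W2" "p \<notin> B1 None" using p(2) N1 W(3) unfolding Wc_def by auto
    then have "p = y2 \<or> p \<in> B2 None" using p(1) Y(2) by (metis IntI Un_iff singletonD)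
    then have "p \<in> B2 None" using B2(2) by blast
    then show ?thesis using False by (simp add: M_def)
  qed
  have AC: False if p: "p \<in> ?A" "p \<in> ?C" for p
  proof (cases "p \<in> W1 \<union> W2")
    case True
    then obtain c where "p \<in> Wc c" unfolding Wc_def by (metis UnE)
    then show False using SM[OF none A_in[OF p(1)]] C_in[OF p(2)] by blast
  next
    case False
    then have "p \<in> X" "p \<in> Y" using p B1(4) B2(4) N1 by auto
    then show False using s(3) by blast
  qed
  have M_A: False if "v \<in> pverts ?H" "p \<in> M c v" "p \<in> ?A" for c v p
    using SM[OF that(1) A_in[OF that(3) MW[OF that(1,2)]]] that(2) by blast
  have M_C: "v = None" if "v \<in> pverts ?H" "p \<in> M c v" "p \<in> ?C" for c v p
    using Mdisj[OF that(1) none that(2) C_in[OF that(3) MW[OF that(1,2)]]] .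
  have M_M: "c = c'" if "u \<in> pverts ?H" "v \<in> pverts ?H" "p \<in> M c u" "p \<in> M c' v" for c c' u v p
    using MW[OF that(1,3)] MW[OF that(2,4)] W(3) unfolding Wc_def by (cases c; cases c') auto
  have part: "Some (butlast ys) \<in> pverts ?H" if "Some ys \<in> pverts (bin_tree_plus (Suc j))" for ys
    using that some some' by auto
  have "model_in (bin_tree_plus (Suc j)) W ?B"
  proof (rule model_inI)
    fix v assume v: "v \<in> pverts (bin_tree_plus (Suc j))"
    have "?A \<subseteq> W" "?C \<subseteq> W" using s(1,2) B1(4) B2(4) N1 W(1,2) by auto
    then show "?B v \<subseteq> W"
      using v inW[OF part] by (cases v) auto
    show "conn (?B v)" using v connA connC MI(2)[OF part] by (cases v) auto
    fix u p assume u: "u \<in> pverts (bin_tree_plus (Suc j))" and p: "p \<in> ?B u" "p \<in> ?B v"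
    have *: "Some xs = Some ys"
      if x: "Some xs \<in> pverts (bin_tree_plus (Suc j))" "p \<in> ?M xs" and y: "Some ys \<in> pverts (bin_tree_plus (Suc j))" "p \<in> ?M ys"
      for xs ys
    proof (cases "xs = [] \<or> ys = []")
      case True
      then show ?thesis using x(2) y(2) M_A[OF part[OF x(1)]] M_A[OF part[OF y(1)]] by (auto split: if_splits)
    next
      case False
      then have xy: "p \<in> M (last xs) (Some (butlast xs))" "p \<in> M (last ys) (Some (butlast ys))" using x(2) y(2) by auto
      then have "last xs = last ys" using M_M[OF part[OF x(1)] part[OF y(1)]] by blast
      moreover from this have "butlast xs = butlast ys"
        using Mdisj[OF part[OF x(1)] part[OF y(1)] xy(1)] xy(2) by simp
      ultimately have "butlast xs @ [last xs] = butlast ys @ [last ys]" by simp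
      then show ?thesis using False by (metis append_butlast_last_id)
    qed
    have **: False if x: "Some xs \<in> pverts (bin_tree_plus (Suc j))" "p \<in> ?M xs" and C: "p \<in> ?C" for xs
      using x(2) AC[OF _ C] M_C[OF part[OF x(1)] _ C] by (auto split: if_splits)
    show "u = v"
    proof (cases u; cases v)
      fix xs ys assume "u = Some xs" "v = Some ys"
      then show ?thesis using *[of xs ys] u v p by simp
    next
      fix xs assume "u = Some xs" "v = None"
      then show ?thesis using **[of xs] u p by simp
    next
      fix xs assume "v = Some xs" "u = None"
      then show ?thesis using **[of xs] v p by simp
    qed simp
  next
    fix u v assume uv: "(u, v) \<in> parcs (bin_tree_plus (Suc j))"
    have down: "\<exists>p \<in> ?M xs. \<exists>q \<in> ?M (d # xs). E p q" if "length xs \<le> j" for xs d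
    proof (cases "xs = []")
      case True
      have "\<exists>p \<in> Sc d. \<exists>q \<in> M d (Some []). E p q" using B1(7) B2(7) unfolding Sc_def M_def by simp
      moreover have "Sc d \<subseteq> ?A" unfolding Sc_def by auto
      ultimately show ?thesis using True by auto
    next
      case False
      have "length (butlast xs) < j" using that False by (cases xs) auto
      then have "(butlast xs, d # butlast xs) \<in> parcs (bin_tree j)" by (simp add: bin_tree_def)
      from imageI[OF this, of "map_prod Some Some"]
      have "(Some (butlast xs), Some (d # butlast xs)) \<in> parcs ?H" by (simp add: bin_tree_plus_def)
      from Medge[OF this, of "last xs"] show ?thesis using False by simp
    qed
    have leaf: "\<exists>p \<in> ?M xs. \<exists>q \<in> ?C. E p q" if "length xs = Suc j" for xs
    proof -
      have "(Some (butlast xs), None) \<in> parcs ?H" using that by (auto simp: bin_tree_plus_def)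
      from Medge[OF this, of "last xs"] obtain p q where "p \<in> M (last xs) (Some (butlast xs))" "q \<in> M (last xs) None" "E p q"
        by blast
      moreover have "M (last xs) None \<subseteq> ?C" unfolding M_def by auto
      moreover have "xs \<noteq> []" using that by auto
      ultimately show ?thesis by (intro bexI[of _ p] bexI[of _ q]) auto
    qed
    from uv consider xs d where "u = Some xs" "v = Some (d # xs)" "length xs \<le> j"
      | xs d where "v = Some xs" "u = Some (d # xs)" "length xs \<le> j"
      | xs where "u = None" "v = Some xs" "length xs = Suc j" | xs where "u = Some xs" "v = None" "length xs = Suc j"
      by (auto simp: bin_tree_plus_def bin_tree_def)
    then show "\<exists>x \<in> ?B u. \<exists>y \<in> ?B v. E x y"
    proof cases
      case 1
      then show ?thesis using down[OF 1(3)] by simp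
    next
      case 2
      obtain p q where "p \<in> ?M xs" "q \<in> ?M (d # xs)" "E p q" using down[OF 2(3)] by blast
      then have "q \<in> ?B u" "p \<in> ?B v" "E q p" using 2 E_sym by auto
      then show ?thesis by blast
    next
      case 3
      obtain p q where "p \<in> ?M xs" "q \<in> ?C" "E p q" using leaf[OF 3(3)] by blast
      then have "q \<in> ?B u" "p \<in> ?B v" "E q p" using 3 E_sym by auto
      then show ?thesis by blast
    next
      case 4
      then show ?thesis using leaf[OF 4(3)] by simp
    qed
  qed
  then show ?thesis unfolding rooted_plus_def using ab by (intro exI[of _ ?B]) auto
qed

section \<open>The induction\<close>

text \<open>In a cycle the hypothesis is used with \<open>i\<close> lowered, in a theta with
  \<open>j\<close> lowered. If the lowered target is missed in one of the two subsets, the other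
  target holds there at full size and only has to be extended to \<open>a\<close> and
  \<open>b\<close>.\<close>

lemma rooted_nabla_or_plus:
  assumes "l \<ge> 1" "biconn W" "finite W" "has_minor_in (bin_tree (1 + (i + j) * (2 * (l + 2)))) W"
    and "\<not> has_minor_in (bin_tree_plus l) W" "a \<in> W" "b \<in> W" "a \<noteq> b"
  shows "rooted_nabla i W a b \<or> rooted_plus j W a b"
  using assms
proof (induction "i + j" arbitrary: i j W a b)
  case 0
  then show ?case using rooted_nabla_0[OF 0(3,7,8,9)] by simp
next
  case (Suc n)
  \<comment> \<open>The height left for the induction hypothesis. The difference of
    \<open>2 * (l + 2)\<close> levels pays for passing to \<open>W1\<close>, \<open>W2\<close> and
    then, in \<open>plus_pred\<close>, to \<open>T\<close> inside one of them.\<close>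
  let ?k = "1 + n * (2 * (l + 2))"
  note W = Suc.prems(2,3) and l = Suc.prems(1) and no_plus = Suc.prems(5) and ab = Suc.prems(6-8)
  consider "i = 0" | "j = 0" | i' j' where "i = Suc i'" "j = Suc j'" by (metis not0_implies_Suc)
  then show ?case
  proof cases
    case 1
    then show ?thesis using rooted_nabla_0[OF W(1) ab] by simp
  next
    case 2
    then show ?thesis using rooted_plus_0[OF W(1) ab] by simp
  next
    case 3
    have sum: "n = i' + j" "n = i + j'" using Suc.hyps(2) 3 by auto
    have "1 + (i + j) * (2 * (l + 2)) = (?k + l + 2) + l + 2" using Suc.hyps(2)[symmetric] by simp
    then have big: "has_minor_in (bin_tree ((?k + l + 2) + l + 2)) W" using Suc.prems(4) by metis
    have ge1: "?k + l + 2 \<ge> 1" "?k \<ge> 1" by simp_all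
    obtain W1 W2 where W12: "W1 \<subseteq> W" "W2 \<subseteq> W" "W1 \<inter> W2 = {}" "biconn W1" "biconn W2" "conn (W - W1)" "conn (W - W2)"
      "has_minor_in (bin_tree (?k + l + 2)) W1" "has_minor_in (bin_tree (?k + l + 2)) W2" "a \<notin> W1 \<union> W2" "b \<notin> W1 \<union> W2"
      using two_biconnected_subsets[OF W ge1(1) l big no_plus] by metis
    have no_sub: "\<not> has_minor_in (bin_tree_plus l) U" if "U \<subseteq> W" for U
      using no_plus has_minor_in_mono that by blast
    have nabla_pred: "rooted_nabla i' U x y \<or> rooted_plus j U x y"
      if U: "U \<subseteq> W" "biconn U" "has_minor_in (bin_tree (?k + l + 2)) U" and xy: "x \<in> U" "y \<in> U" "x \<noteq> y" for U x y
    proof -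
      have "has_minor_in (bin_tree (1 + (i' + j) * (2 * (l + 2)))) U"
        using has_bin_tree_le[OF U(3)] sum(1) by simp
      then show ?thesis
        using Suc.hyps(1)[OF sum(1) l U(2) finite_subset[OF U(1) W(2)] _ no_sub[OF U(1)] xy] by blast
    qed
    \<comment> \<open>Here \<open>T\<close> is chosen to avoid \<open>x\<close>, so the link from
      \<open>x\<close> to \<open>T\<close> has a nonempty part outside \<open>T\<close>, which
      becomes the stem.\<close>
    have plus_pred: "rooted_nabla i U x y \<or> planted_plus j' U x y"
      if U: "U \<subseteq> W" "biconn U" "has_minor_in (bin_tree (?k + l + 2)) U" and xy: "x \<in> U" "y \<in> U" "x \<noteq> y" for U x y
    proof -
      have finU: "finite U" using finite_subset[OF U(1) W(2)] .
      obtain T where T: "T \<subseteq> U" "biconn T" "has_minor_in (bin_tree ?k) T" "x \<notin> T" "y \<notin> T"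
        using two_biconnected_subsets[OF U(2) finU ge1(2) l U(3) no_sub[OF U(1)], of x y] by (metis UnCI)
      obtain t t' where t: "t \<in> T" "t' \<in> T" "t \<noteq> t'" using T(2) unfolding biconnected_on_def by blast
      obtain Q Q' q q' where Q: "conn Q" "Q \<subseteq> U" "x \<in> Q" "conn Q'" "Q' \<subseteq> U" "y \<in> Q'" "Q \<inter> Q' = {}"
        "Q \<inter> T = {q}" "Q' \<inter> T = {q'}" "conn (Q - {q}) \<and> (\<exists>p \<in> Q - {q}. E p q)"
        using two_disjoint_paths_to_set[OF U(2) xy T(1) t] T(4) by metis
      have "q \<in> Q \<inter> T" "q' \<in> Q' \<inter> T" by (simp_all only: Q(8,9) singletonI)
      then have q: "q \<in> T" "q' \<in> T" "q \<noteq> q'" using Q(7) by auto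
      have "has_minor_in (bin_tree (1 + (i + j') * (2 * (l + 2)))) T" using T(3) sum(2) by simp
      moreover have "T \<subseteq> W" using T(1) U(1) by blast
      ultimately have "rooted_nabla i T q q' \<or> rooted_plus j' T q q'"
        using Suc.hyps(1)[OF sum(2) l T(2) finite_subset[OF _ W(2)] _ no_sub q] by blast
      then show ?thesis
      proof
        assume "rooted_nabla i T q q'"
        then have "rooted_nabla i U x y" by (rule rooted_nabla_extend[OF _ Q(1,2,8,4,5,9,7) T(1) Q(3,6)])
        then show ?thesis ..
      next
        assume *: "rooted_plus j' T q q'"
        obtain p where "p \<in> Q - {q}" "E p q" using Q(10) by blast
        moreover have "x \<in> Q - {q}" using Q(3) q T(4) by blast
        ultimately have "planted_plus j' U x y"
          using planted_plus_extend[OF * _ _ _ Q(2,8,4,5,9,7) T(1) _ Q(6)] Q(10) by blast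
        then show ?thesis ..
      qed
    qed
    have cycle: "rooted_nabla i W a b \<or> rooted_plus j W a b"
      if cyc: "cycle_type W a b U1 U2"
        and U1: "U1 \<subseteq> W" "biconn U1" "has_minor_in (bin_tree (?k + l + 2)) U1"
        and U2: "U2 \<subseteq> W" "biconn U2" "has_minor_in (bin_tree (?k + l + 2)) U2" and U12: "U1 \<inter> U2 = {}" for U1 U2
    proof -
      obtain X Y Z p q x y1 y2 z where c: "conn X" "conn Y" "conn Z" and s: "X \<subseteq> W" "Y \<subseteq> W" "Z \<subseteq> W"
        and d: "X \<inter> Y = {}" "X \<inter> Z = {}" "Y \<inter> Z = {}" and m: "a \<in> X" "b \<in> Z" "p \<in> X" "q \<in> Z" "E p q"
        and X: "X \<inter> U1 = {x}" "X \<inter> U2 = {}" and Y: "Y \<inter> U1 = {y1}" "Y \<inter> U2 = {y2}"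
        and Z: "Z \<inter> U1 = {}" "Z \<inter> U2 = {z}"
        using cyc by (rule cycle_typeE)
      have "x \<in> X \<inter> U1" "y1 \<in> Y \<inter> U1" "y2 \<in> Y \<inter> U2" "z \<in> Z \<inter> U2" by (simp_all only: X Y Z singletonI)
      then have i: "x \<in> U1" "y1 \<in> U1" "x \<noteq> y1" "y2 \<in> U2" "z \<in> U2" "y2 \<noteq> z"
        and xX: "x \<in> X" "y1 \<in> Y" "y2 \<in> Y" "z \<in> Z" using d(1,3) by auto
      consider "rooted_nabla i' U1 x y1" "rooted_nabla i' U2 y2 z" | "rooted_plus j U1 x y1" | "rooted_plus j U2 y2 z"
        using nabla_pred[OF U1 i(1-3)] nabla_pred[OF U2 i(4-6)] by blast
      then show ?thesis
      proof cases
        case 1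
        have "rooted_nabla (Suc i') W a b"
          by (rule rooted_nabla_Suc[OF 1 U1(1) U2(1) U12 c s d m X Y Z])
        then show ?thesis using 3(1) by simp
      next
        case 2
        \<comment> \<open>The apex reaches \<open>b\<close> through all of \<open>U2\<close>; in the
          next case it is the root that reaches \<open>a\<close> through all of
          \<open>U1\<close>.\<close>
        have "conn (Y \<union> U2)" using conn_Un[OF c(2) biconnected_on_connected[OF U2(2)]] Y(2) by blast
        then have "conn (Y \<union> U2 \<union> Z)" using conn_Un[OF _ c(3)] xX(4) i(5) by blast
        moreover have "(Y \<union> U2 \<union> Z) \<inter> U1 = {y1}" using Y(1) Z(1) U12 by (simp add: Int_Un Int_commute)
        moreover have "X \<inter> (Y \<union> U2 \<union> Z) = {}" using d X(2) by (simp add: Int_Un)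
        ultimately have "rooted_plus j W a b"
          using rooted_plus_extend[OF 2 c(1) s(1) X(1), of "Y \<union> U2 \<union> Z" a b] s U1(1) U2(1) m by simp
        then show ?thesis ..
      next
        case 3
        have "conn (Y \<union> U1)" using conn_Un[OF c(2) biconnected_on_connected[OF U1(2)]] Y(1) by blast
        then have "conn (Y \<union> U1 \<union> X)" using conn_Un[OF _ c(1)] xX(1) i(1) by blast
        moreover have "(Y \<union> U1 \<union> X) \<inter> U2 = {y2}" using Y(2) X(2) U12 by (simp add: Int_Un Int_commute)
        moreover have "(Y \<union> U1 \<union> X) \<inter> Z = {}" using d Z(1) by (simp add: Int_Un Int_commute)
        ultimately have "rooted_plus j W a b"
          using rooted_plus_extend[OF 3, of "Y \<union> U1 \<union> X" W Z a b] c s U1(1) U2(1) m Z(2) by simp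
        then show ?thesis ..
      qed
    qed
    have "theta_or_cycle W a b W1 W2"
      using theta_or_cycle[OF W W12(1-7) ab W12(10,11)] .
    then consider "theta_type W a b W1 W2" | "cycle_type W a b W1 W2" | "cycle_type W a b W2 W1"
      unfolding theta_or_cycle_def by blast
    then show ?thesis
    proof cases
      case 1
      then obtain X Y x1 x2 y1 y2 where c: "conn X" "conn Y" and s: "X \<subseteq> W" "Y \<subseteq> W" "X \<inter> Y = {}"
        and m: "a \<in> X" "b \<in> Y" and X: "X \<inter> W1 = {x1}" "X \<inter> W2 = {x2}" and Y: "Y \<inter> W1 = {y1}" "Y \<inter> W2 = {y2}"
        by (rule theta_typeE)
      have i: "x1 \<in> W1" "y1 \<in> W1" "x1 \<noteq> y1" "x2 \<in> W2" "y2 \<in> W2" "x2 \<noteq> y2"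
      proof -
        have "x1 \<in> X \<inter> W1" "x2 \<in> X \<inter> W2" "y1 \<in> Y \<inter> W1" "y2 \<in> Y \<inter> W2" by (simp_all only: X Y singletonI)
        then show "x1 \<in> W1" "y1 \<in> W1" "x1 \<noteq> y1" "x2 \<in> W2" "y2 \<in> W2" "x2 \<noteq> y2" using s(3) by auto
      qed
      consider "rooted_nabla i W1 x1 y1" | "rooted_nabla i W2 x2 y2" | "planted_plus j' W1 x1 y1" "planted_plus j' W2 x2 y2"
        using plus_pred[OF W12(1,4,8) i(1-3)] plus_pred[OF W12(2,5,9) i(4-6)] by blast
      then show ?thesis
      proof cases
        case 1
        have "rooted_nabla i W a b" by (rule rooted_nabla_extend[OF 1 c(1) s(1) X(1) c(2) s(2) Y(1) s(3) W12(1) m])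
        then show ?thesis ..
      next
        case 2
        have "rooted_nabla i W a b" by (rule rooted_nabla_extend[OF 2 c(1) s(1) X(2) c(2) s(2) Y(2) s(3) W12(2) m])
        then show ?thesis ..
      next
        case p: 3
        have "rooted_plus (Suc j') W a b" by (rule rooted_plus_Suc[OF p W12(1-3) c s m X Y])
        then show ?thesis using 3(2) by simp
      qed
    next
      case 2
      then show ?thesis using cycle[OF _ W12(1,4,8) W12(2,5,9) W12(3)] by blast
    next
      case c: 3
      have "W2 \<inter> W1 = {}" using W12(3) by blast
      then show ?thesis using cycle[OF c W12(2,5,9) W12(1,4,8)] by blast
    qed
  qed
qed

end

section \<open>Passage from graphs to symmetric relations\<close>

lemma connected_induce_iff:
  assumes "pair_graph G" "S \<subseteq> pverts G"
  shows "connected (with_proj G \<restriction> S) \<longleftrightarrow> connected_on (\<lambda>x y. (x, y) \<in> parcs G) S"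
proof -
  interpret pair_graph G by fact
  have sym: "(x, y) \<in> parcs G \<longleftrightarrow> (y, x) \<in> parcs G" for x y
    using sym_arcs by (auto simp: symmetric_def dest: symD)
  let ?R = "{(x, y) \<in> parcs G. x \<in> S \<and> y \<in> S}"
  \<comment> \<open>\<open>connected\<close> is defined by reachability in the symmetric closure,
    which adds nothing because \<open>parcs G\<close> is symmetric.\<close>
  have arcs: "parcs (mk_symmetric (with_proj G \<restriction> S)) = ?R"
    using sym by (auto simp: parcs_mk_symmetric induce_subgraph_def)
  have conn: "connected (with_proj G \<restriction> S) \<longleftrightarrow> S \<noteq> {} \<and> (\<forall>u \<in> S. \<forall>v \<in> S. (u, v) \<in> rtrancl_on S ?R)"
    unfolding connected_def strongly_connected_def reachable_def by (simp add: arcs)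
  show ?thesis
  proof
    assume "connected (with_proj G \<restriction> S)"
    then have ne: "S \<noteq> {}" and r: "\<And>u v. u \<in> S \<Longrightarrow> v \<in> S \<Longrightarrow> (u, v) \<in> rtrancl_on S ?R" using conn by auto
    show "connected_on (\<lambda>x y. (x, y) \<in> parcs G) S"
    proof (rule connected_onI[OF ne])
      fix X assume X: "X \<subseteq> S" "X \<noteq> {}" "\<And>x y. x \<in> X \<Longrightarrow> y \<in> S \<Longrightarrow> (x, y) \<in> parcs G \<Longrightarrow> y \<in> X"
      then obtain u where u: "u \<in> X" by blast
      have "v \<in> X" if "v \<in> S" for v
      proof -
        have "(u, v) \<in> rtrancl_on S ?R" using r u X(1) that by blast
        then show ?thesis by (induction rule: rtrancl_on_induct) (use u X(3) in auto)
      qed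
      then show "X = S" using X(1) by blast
    qed
  next
    assume c: "connected_on (\<lambda>x y. (x, y) \<in> parcs G) S"
    have "(u, v) \<in> rtrancl_on S ?R" if "u \<in> S" "v \<in> S" for u v
    proof -
      have "{w \<in> S. (u, w) \<in> rtrancl_on S ?R} = S"
        by (rule connected_onD[OF c]) (use that in \<open>auto intro: rtrancl_on_into_rtrancl_on\<close>)
      then show ?thesis using that by blast
    qed
    then show "connected (with_proj G \<restriction> S)" using conn connected_on_nonempty[OF c] by blast
  qed
qed

lemma symmetric_relation_parcs:
  assumes "pair_graph G"
  shows "symmetric_relation (\<lambda>x y. (x, y) \<in> parcs G)"
proof -
  interpret pair_graph G by fact
  show ?thesis by unfold_locales (use sym_arcs in \<open>auto simp: symmetric_def dest: symD\<close>)
qed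

lemma is_minor_iff_has_minor_in:
  assumes "pair_graph G"
  shows "is_minor H G \<longleftrightarrow> symmetric_relation.has_minor_in (\<lambda>x y. (x, y) \<in> parcs G) H (pverts G)"
proof -
  interpret R: symmetric_relation "\<lambda>x y. (x, y) \<in> parcs G"
    using assms by (rule symmetric_relation_parcs)
  have "S \<subseteq> pverts G \<and> connected (with_proj G \<restriction> S) \<longleftrightarrow> S \<subseteq> pverts G \<and> R.conn S" for S
    using connected_induce_iff[OF assms] by blast
  then show ?thesis
    unfolding is_minor_def minor_model_def R.has_minor_in_def R.model_in_def by simp
qed

theorem theorem1p4:
  fixes l :: nat
  assumes "l \<ge> 1"
  shows "\<exists>k::nat. \<forall>G :: 'a pair_pre_digraph.
    pair_graph G \<and> k_connected 2 G \<and> is_minor (bin_tree k) G \<longrightarrow>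
    is_minor (bin_tree_plus l) G \<or> is_minor (nabla l) G"
proof (intro exI allI impI)
  fix G :: "'a pair_pre_digraph"
  \<comment> \<open>The witness for \<open>k\<close> is the height that
    \<open>rooted_nabla_or_plus\<close> asks for when \<open>i = j = l\<close>.\<close>
  assume "pair_graph G \<and> k_connected 2 G \<and> is_minor (bin_tree (1 + (l + l) * (2 * (l + 2)))) G"
  then have G: "pair_graph G" and two: "k_connected 2 G"
    and big: "is_minor (bin_tree (1 + (l + l) * (2 * (l + 2)))) G" by auto
  interpret pair_graph G by fact
  let ?E = "\<lambda>x y. (x, y) \<in> parcs G"
  interpret R: symmetric_relation ?E
    using G by (rule symmetric_relation_parcs)
  note minor_iff = is_minor_iff_has_minor_in[OF G]
  have card: "2 < card (pverts G)" using two unfolding k_connected_def by blast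
  then have "\<not> card (pverts G) \<le> Suc 0" by simp
  then obtain a b where ab: "a \<in> pverts G" "b \<in> pverts G" "a \<noteq> b"
    by (subst (asm) card_le_Suc0_iff_eq[OF pair_finite_verts]) blast
  have conn: "R.conn (pverts G - X)" if "X \<subseteq> pverts G" "card X < 2" for X
    using two that connected_induce_iff[OF G, of "pverts G - X"] unfolding k_connected_def by blast
  \<comment> \<open>Deleting no vertex gives connectedness, deleting one vertex the absence of cut
    vertices.\<close>
  have bi: "R.biconn (pverts G)"
    unfolding biconnected_on_def using ab conn[of "{}"] conn[of "{_}"] by auto
  show "is_minor (bin_tree_plus l) G \<or> is_minor (nabla l) G"
  proof (cases "is_minor (bin_tree_plus l) G")
    case False
    then have "R.rooted_nabla l (pverts G) a b \<or> R.rooted_plus l (pverts G) a b"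
      using R.rooted_nabla_or_plus[OF assms bi pair_finite_verts _ _ ab] big unfolding minor_iff by blast
    then show ?thesis
      unfolding minor_iff R.has_minor_in_def R.rooted_nabla_def R.rooted_plus_def by blast
  qed simp
qed

end
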